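(* Let $R$ be a commutative unital ring, $G$ a finite group and $X$ a finite $G$-set. If $X$ decomposes in $G$-orbits as $X=\bigsqcup_{i=1}^nO_i$ and $G_i$ is the stabilizer of an element in $O_i$, then in $\mathscr{C}_R$ $$\frac{X}{G}\cong \bigoplus_{i=1}^n\frac{\{\bullet\}}{G_i}.$$
   Context: $\{\bullet\}$ denotes a one-point set with trivial action, and $\oplus$ the direct sum in the additive category $\mathscr{C}_R$, given on objects by $\frac{X}{G}\oplus\frac{Y}{H}=\frac{(X\times H)\sqcup (G\times Y)}{G\times H}$ with componentwise $(G\times H)$-actions. All groups and sets with group action are finite; actions are left actions unless stated otherwise. For a finite group $\Gamma$ and a finite $\Gamma$-set $Z$, $B(Z)$ denotes the Grothendieck group, for the relations given by disjoint union, of the category of finite $\Gamma$-sets over $Z$ (pairs $(S,\varphi)$ with $\varphi:S\to Z$ a morphism of $\Gamma$-sets; isomorphisms are $\Gamma$-isomorphisms commuting with the maps to $Z$). The category $\mathscr{C}_R$: Objects are pairs $(G,X)$ with $G$ a finite group and $X$ a finite $G$-set, written $\frac{X}{G}$ or $X/G$. Morphisms: given $X/G$ and $Y/H$, regard $X$ and $Y$ as $(H\times G)$-sets through the projections ($H$ acts trivially on $X$, $G$ acts trivially on $Y$), and set $\mathrm{Hom}_{\mathscr{C}_R}(X/G,Y/H)=RB^{H,G}(Y,X):=R\otimes_{\mathbb Z}B(Y\times X)$, with $Y\times X$ viewed as an $(H\times G)$-set. It is generated by the classes $\langle U,\beta,\alpha\rangle$ of spans $Y\xleftarrow{\beta}U\xrightarrow{\alpha}X$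 of $(H\times G)$-sets. An $(H\times G)$-set is identified with an $(H,G)$-biset through $(h,g)u=hug^{-1}$; so $\beta(hug)=h\beta(u)$ and $\alpha(hug)=g^{-1}\alpha(u)$. Composition: for $\langle U,\beta,\alpha\rangle\in RB^{H,G}(Y,X)$ and $\langle V,\delta,\gamma\rangle\in RB^{K,H}(Z,Y)$, $\langle V,\delta,\gamma\rangle\circ\langle U,\beta,\alpha\rangle=\langle V\hat\times_HU,\hat\delta,\hat\alpha\rangle$, where $V\times_HU$ is the set of orbits $[v,u]$ of $V\times U$ under the right $H$-action $(v,u)\cdot h=(vh,h^{-1}u)$, $V\hat\times_HU=\{[v,u]\in V\times_HU\mid\gamma(v)=\beta(u)\}$ with the natural $(K\times G)$-action, $\hat\delta[v,u]=\delta(v)$, $\hat\alpha[v,u]=\alpha(u)$; this is extended $R$-bilinearly. Identity of $X/G$: $\langle G\times X,\underline1,\overline1\rangle$, with $(a,b)(g,x)=(agb^{-1},ax)$, $\underline1(g,x)=x$, $\overline1(g,x)=g^{-1}x$. *)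

theory Defs
  imports "HOL-Algebra.Algebra" "HOL-Library.Countable_Set"
begin

section \<open>Finite sets with a group action\<close>

record ('g, 'x) gset =
  grp :: "'g monoid"
  pts :: "'x set"
  gact :: "'g \<Rightarrow> 'x \<Rightarrow> 'x"

text \<open>The definitions below are meant for \<open>group_action (grp A) (pts A) (gact A)\<close> with
  \<open>grp A\<close> and \<open>pts A\<close> finite; these are the objects \<open>X/G\<close> of the category.\<close>

text \<open>The set \<open>Y \<times> X\<close> with its componentwise \<open>(H \<times> G)\<close>-action. It is the product of
  \<open>Y\<close> and \<open>X\<close>, both regarded as \<open>(H \<times> G)\<close>-sets through the projections.\<close>

definition ext_prod :: "('h, 'y) gset \<Rightarrow> ('g, 'x) gset \<Rightarrow> ('h \<times> 'g, 'y \<times> 'x) gset" where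
  "ext_prod B A =
     \<lparr>grp = grp B \<times>\<times> grp A,
      pts = pts B \<times> pts A,
      gact = (\<lambda>(h, g). restrict (map_prod (gact B h) (gact A g)) (pts B \<times> pts A))\<rparr>"


section \<open>Finite \<open>\<Gamma>\<close>-sets over \<open>Z\<close>\<close>

text \<open>\<open>'p\<close> is the type of the acting group, \<open>'u\<close> that of the elements of the total
  space, \<open>'z\<close> that of the base.\<close>

record ('p, 'u, 'z) slice =
  tot :: "'u set"
  act :: "'p \<Rightarrow> 'u \<Rightarrow> 'u"
  proj :: "'u \<Rightarrow> 'z"

definition gset_over :: "('p, 'z) gset \<Rightarrow> ('p, 'u, 'z) slice \<Rightarrow> bool" where
  "gset_over Z S \<longleftrightarrow>
     group_action (grp Z) (tot S) (act S) \<and> finite (tot S) \<and>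
     proj S \<in> tot S \<rightarrow> pts Z \<and>
     (\<forall>p \<in> carrier (grp Z). \<forall>u \<in> tot S. proj S (act S p u) = gact Z p (proj S u))"

definition over_iso :: "('p, 'z) gset \<Rightarrow> ('p, 'u, 'z) slice \<Rightarrow> ('p, 'v, 'z) slice \<Rightarrow> bool" where
  "over_iso Z S T \<longleftrightarrow>
     (\<exists>f. bij_betw f (tot S) (tot T) \<and>
       (\<forall>p \<in> carrier (grp Z). \<forall>u \<in> tot S. f (act S p u) = act T p (f u)) \<and>
       (\<forall>u \<in> tot S. proj T (f u) = proj S u))"

definition over_sum :: "('p, 'u, 'z) slice \<Rightarrow> ('p, 'v, 'z) slice \<Rightarrow> ('p, 'u + 'v, 'z) slice" where
  "over_sum S T =
     \<lparr>tot = tot S <+> tot T,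
      act = (\<lambda>p. restrict (map_sum (act S p) (act T p)) (tot S <+> tot T)),
      proj = case_sum (proj S) (proj T)\<rparr>"

text \<open>A copy on a finite set of natural numbers. Every finite \<open>\<Gamma>\<close>-set over \<open>Z\<close> has one,
  so the Grothendieck group below can be generated by the \<open>\<Gamma>\<close>-sets over \<open>Z\<close> that live
  on sets of natural numbers.\<close>

definition nat_copy :: "('p, 'u, 'z) slice \<Rightarrow> ('p, nat, 'z) slice" where
  "nat_copy S = (let U = tot S; N = to_nat_on U ` U in
     \<lparr>tot = N,
      act = (\<lambda>p. \<lambda>n\<in>N. to_nat_on U (act S p (from_nat_into U n))),
      proj = (\<lambda>n. proj S (from_nat_into U n))\<rparr>)"


section \<open>The Grothendieck group \<open>B(Z)\<close>\<close>

abbreviation burnside_free :: "('p, 'z) gset \<Rightarrow> (('p, nat, 'z) slice \<Rightarrow>\<^sub>0 int) monoid" where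
  "burnside_free Z \<equiv> free_Abelian_group {S. gset_over Z S}"

definition burnside_rel :: "('p, 'z) gset \<Rightarrow> (('p, nat, 'z) slice \<Rightarrow>\<^sub>0 int) set" where
  "burnside_rel Z = generate (burnside_free Z)
     ({frag_of S - frag_of T |S T. gset_over Z S \<and> gset_over Z T \<and> over_iso Z S T} \<union>
      {frag_of (nat_copy (over_sum S T)) - frag_of S - frag_of T |S T.
         gset_over Z S \<and> gset_over Z T})"

definition burnside :: "('p, 'z) gset \<Rightarrow> (('p, nat, 'z) slice \<Rightarrow>\<^sub>0 int) set monoid" where
  "burnside Z = burnside_free Z Mod burnside_rel Z"

definition over_class ::
    "('p, 'z) gset \<Rightarrow> ('p, 'u, 'z) slice \<Rightarrow> (('p, nat, 'z) slice \<Rightarrow>\<^sub>0 int) set" where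
  "over_class Z S = burnside_rel Z #>\<^bsub>burnside_free Z\<^esub> frag_of (nat_copy S)"


section \<open>Tensor product of abelian groups\<close>

abbreviation tensor_free ::
    "('a, 'm) monoid_scheme \<Rightarrow> ('b, 'n) monoid_scheme \<Rightarrow> ('a \<times> 'b \<Rightarrow>\<^sub>0 int) monoid" where
  "tensor_free P Q \<equiv> free_Abelian_group (carrier P \<times> carrier Q)"

definition tensor_rel ::
    "('a, 'm) monoid_scheme \<Rightarrow> ('b, 'n) monoid_scheme \<Rightarrow> ('a \<times> 'b \<Rightarrow>\<^sub>0 int) set" where
  "tensor_rel P Q = generate (tensor_free P Q)
     ({frag_of (p \<otimes>\<^bsub>P\<^esub> p', q) - frag_of (p, q) - frag_of (p', q) |p p' q.
         p \<in> carrier P \<and> p' \<in> carrier P \<and> q \<in> carrier Q} \<union>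
      {frag_of (p, q \<otimes>\<^bsub>Q\<^esub> q') - frag_of (p, q) - frag_of (p, q') |p q q'.
         p \<in> carrier P \<and> q \<in> carrier Q \<and> q' \<in> carrier Q})"

definition tensor ::
    "('a, 'm) monoid_scheme \<Rightarrow> ('b, 'n) monoid_scheme \<Rightarrow> ('a \<times> 'b \<Rightarrow>\<^sub>0 int) set monoid" where
  "tensor P Q = tensor_free P Q Mod tensor_rel P Q"

definition pure_tensor ::
    "('a, 'm) monoid_scheme \<Rightarrow> ('b, 'n) monoid_scheme \<Rightarrow> 'a \<Rightarrow> 'b \<Rightarrow> ('a \<times> 'b \<Rightarrow>\<^sub>0 int) set" where
  "pure_tensor P Q p q = tensor_rel P Q #>\<^bsub>tensor_free P Q\<^esub> frag_of (p, q)"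


section \<open>Spans and their composition\<close>

text \<open>A span \<open>Y \<leftarrow> U \<rightarrow> X\<close> with legs \<open>\<beta>\<close>, \<open>\<alpha>\<close> is an \<open>(H \<times> G)\<close>-set \<open>U\<close> over \<open>Y \<times> X\<close> with
  \<open>proj u = (\<beta> u, \<alpha> u)\<close>. In biset notation, \<open>h u g\<inverse>\<close> is \<open>act U (h, g) u\<close>; in particular
  \<open>h u = act U (h, 1) u\<close> and, for a \<open>(K, H)\<close>-biset \<open>V\<close>, \<open>v h = act V (1, h\<inverse>) v\<close>.\<close>

text \<open>The orbit \<open>[v, u]\<close> of \<open>(v, u)\<close> under \<open>(v, u) \<cdot> h = (v h, h\<inverse> u)\<close>.\<close>

definition span_orbit ::
    "('g, 'x) gset \<Rightarrow> ('h, 'y) gset \<Rightarrow> ('k, 'z) gset \<Rightarrow>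
     ('k \<times> 'h, 'v, 'z \<times> 'y) slice \<Rightarrow> ('h \<times> 'g, 'u, 'y \<times> 'x) slice \<Rightarrow> 'v \<Rightarrow> 'u \<Rightarrow> ('v \<times> 'u) set" where
  "span_orbit A B C V U v u =
     {(act V (\<one>\<^bsub>grp C\<^esub>, inv\<^bsub>grp B\<^esub> h) v, act U (inv\<^bsub>grp B\<^esub> h, \<one>\<^bsub>grp A\<^esub>) u) |h. h \<in> carrier (grp B)}"

text \<open>In \<open>span_comp\<close>, the element \<open>(k, g)\<close> sends \<open>[v, u]\<close> to \<open>[(k, 1) v, (1, g) u]\<close>, which
  is the image of the orbit \<open>[v, u]\<close>, and \<open>(\<delta> v, \<alpha> u)\<close> is constant on the orbit.\<close>

definition span_comp ::
    "('g, 'x) gset \<Rightarrow> ('h, 'y) gset \<Rightarrow> ('k, 'z) gset \<Rightarrow>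
     ('k \<times> 'h, 'v, 'z \<times> 'y) slice \<Rightarrow> ('h \<times> 'g, 'u, 'y \<times> 'x) slice \<Rightarrow>
     ('k \<times> 'g, ('v \<times> 'u) set, 'z \<times> 'x) slice" where
  "span_comp A B C V U =
     (let W = {span_orbit A B C V U v u |v u.
                 v \<in> tot V \<and> u \<in> tot U \<and> snd (proj V v) = fst (proj U u)} in
     \<lparr>tot = W,
      act = (\<lambda>(k, g). \<lambda>w\<in>W. map_prod (act V (k, \<one>\<^bsub>grp B\<^esub>)) (act U (\<one>\<^bsub>grp B\<^esub>, g)) ` w),
      proj = (\<lambda>w. the_elem ((\<lambda>(v, u). (fst (proj V v), snd (proj U u))) ` w))\<rparr>)"

definition id_span :: "('g, 'x) gset \<Rightarrow> ('g \<times> 'g, 'g \<times> 'x, 'x \<times> 'x) slice" where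
  "id_span A =
     \<lparr>tot = carrier (grp A) \<times> pts A,
      act = (\<lambda>(a, b). \<lambda>(g, x)\<in>carrier (grp A) \<times> pts A.
               (a \<otimes>\<^bsub>grp A\<^esub> g \<otimes>\<^bsub>grp A\<^esub> inv\<^bsub>grp A\<^esub> b, gact A a x)),
      proj = (\<lambda>(g, x). (x, gact A (inv\<^bsub>grp A\<^esub> g) x))\<rparr>"


section \<open>The category\<close>

text \<open>\<open>cr_hom R A B\<close> is the group of morphisms from \<open>A\<close> to \<open>B\<close>.\<close>

definition cr_hom ::
    "('r, 'm) ring_scheme \<Rightarrow> ('g, 'x) gset \<Rightarrow> ('h, 'y) gset \<Rightarrow>
     ('r \<times> (('h \<times> 'g, nat, 'y \<times> 'x) slice \<Rightarrow>\<^sub>0 int) set \<Rightarrow>\<^sub>0 int) set monoid" where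
  "cr_hom R A B = tensor (add_monoid R) (burnside (ext_prod B A))"

text \<open>Composition is the biadditive extension of \<open>span_comp\<close>, first to Burnside groups and
  then to their tensor products with \<open>R\<close>. On cosets it is given by the union, over all
  representatives, of the cosets of the composites: as composition of representatives is
  compatible with the relations, that union is a single coset.\<close>

definition burnside_comp ::
    "('g, 'x) gset \<Rightarrow> ('h, 'y) gset \<Rightarrow> ('k, 'z) gset \<Rightarrow>
     (('k \<times> 'h, nat, 'z \<times> 'y) slice \<Rightarrow>\<^sub>0 int) set \<Rightarrow>
     (('h \<times> 'g, nat, 'y \<times> 'x) slice \<Rightarrow>\<^sub>0 int) set \<Rightarrow>
     (('k \<times> 'g, nat, 'z \<times> 'x) slice \<Rightarrow>\<^sub>0 int) set" where
  "burnside_comp A B C b a =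
     (\<Union>d\<in>b. \<Union>c\<in>a. burnside_rel (ext_prod C A) #>\<^bsub>burnside_free (ext_prod C A)\<^esub>
        frag_extend (\<lambda>V. frag_extend (\<lambda>U. frag_of (nat_copy (span_comp A B C V U))) c) d)"

definition cr_comp ::
    "('r, 'm) ring_scheme \<Rightarrow> ('g, 'x) gset \<Rightarrow> ('h, 'y) gset \<Rightarrow> ('k, 'z) gset \<Rightarrow>
     ('r \<times> (('k \<times> 'h, nat, 'z \<times> 'y) slice \<Rightarrow>\<^sub>0 int) set \<Rightarrow>\<^sub>0 int) set \<Rightarrow>
     ('r \<times> (('h \<times> 'g, nat, 'y \<times> 'x) slice \<Rightarrow>\<^sub>0 int) set \<Rightarrow>\<^sub>0 int) set \<Rightarrow>
     ('r \<times> (('k \<times> 'g, nat, 'z \<times> 'x) slice \<Rightarrow>\<^sub>0 int) set \<Rightarrow>\<^sub>0 int) set" where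
  "cr_comp R A B C \<psi> \<phi> =
     (\<Union>d\<in>\<psi>. \<Union>c\<in>\<phi>. tensor_rel (add_monoid R) (burnside (ext_prod C A))
        #>\<^bsub>tensor_free (add_monoid R) (burnside (ext_prod C A))\<^esub>
        frag_extend (\<lambda>(s, b). frag_extend (\<lambda>(r, a).
          frag_of (s \<otimes>\<^bsub>R\<^esub> r, burnside_comp A B C b a)) c) d)"

definition cr_id ::
    "('r, 'm) ring_scheme \<Rightarrow> ('g, 'x) gset \<Rightarrow>
     ('r \<times> (('g \<times> 'g, nat, 'x \<times> 'x) slice \<Rightarrow>\<^sub>0 int) set \<Rightarrow>\<^sub>0 int) set" where
  "cr_id R A = pure_tensor (add_monoid R) (burnside (ext_prod A A))
     \<one>\<^bsub>R\<^esub> (over_class (ext_prod A A) (id_span A))"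

definition cr_isomorphic ::
    "('r, 'm) ring_scheme \<Rightarrow> ('g, 'x) gset \<Rightarrow> ('h, 'y) gset \<Rightarrow> bool" where
  "cr_isomorphic R A B \<longleftrightarrow>
     (\<exists>\<phi> \<in> carrier (cr_hom R A B). \<exists>\<psi> \<in> carrier (cr_hom R B A).
        cr_comp R A B A \<psi> \<phi> = cr_id R A \<and> cr_comp R B A B \<phi> \<psi> = cr_id R B)"


section \<open>Direct sums\<close>

definition point :: "'g monoid \<Rightarrow> ('g, unit) gset" where
  "point G = \<lparr>grp = G, pts = {()}, gact = (\<lambda>g. \<lambda>x\<in>{()}. x)\<rparr>"

definition dir_sum2 :: "('g, 'x) gset \<Rightarrow> ('h, 'y) gset \<Rightarrow> ('g \<times> 'h, 'x \<times> 'h + 'g \<times> 'y) gset" where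
  "dir_sum2 A B =
     (let P = pts A \<times> carrier (grp B) <+> carrier (grp A) \<times> pts B in
     \<lparr>grp = grp A \<times>\<times> grp B,
      pts = P,
      gact = (\<lambda>(g, h). restrict (map_sum
                (map_prod (gact A g) (\<lambda>h'. h \<otimes>\<^bsub>grp B\<^esub> h'))
                (map_prod (\<lambda>g'. g \<otimes>\<^bsub>grp A\<^esub> g') (gact B h))) P)\<rparr>)"

text \<open>The direct sum of a finite family: the group is the product of all the \<open>G\<^sub>i\<close>, and the set
  is the disjoint union over \<open>i\<close> of the products of \<open>X\<^sub>i\<close> with all the \<open>G\<^sub>j\<close>, \<open>j \<noteq> i\<close>. The
  empty direct sum is the empty set with the action of the trivial group. By the lemma
  \<open>dir_sum_insert\<close> below, this is the iteration of \<open>dir_sum2\<close>.\<close>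

definition dir_sum ::
    "'i set \<Rightarrow> ('i \<Rightarrow> ('g, 'x) gset) \<Rightarrow> ('i \<Rightarrow> 'g, 'i \<times> 'x \<times> ('i \<Rightarrow> 'g)) gset" where
  "dir_sum I A =
     (let P = SIGMA i:I. pts (A i) \<times> (\<Pi>\<^sub>E j\<in>I - {i}. carrier (grp (A j))) in
     \<lparr>grp = product_group I (\<lambda>i. grp (A i)),
      pts = P,
      gact = (\<lambda>g. \<lambda>(i, x, t)\<in>P.
                (i, gact (A i) (g i) x, \<lambda>j\<in>I - {i}. g j \<otimes>\<^bsub>grp (A j)\<^esub> t j))\<rparr>)"

lemma dir_sum_insert:
  assumes "k \<notin> I"
  shows "\<exists>\<theta> \<in> iso (grp (dir_sum (insert k I) A)) (grp (dir_sum2 (A k) (dir_sum I A))).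
         \<exists>f. bij_betw f (pts (dir_sum (insert k I) A)) (pts (dir_sum2 (A k) (dir_sum I A))) \<and>
           (\<forall>g \<in> carrier (grp (dir_sum (insert k I) A)). \<forall>w \<in> pts (dir_sum (insert k I) A).
              f (gact (dir_sum (insert k I) A) g w) = gact (dir_sum2 (A k) (dir_sum I A)) (\<theta> g) (f w))"
proof -
  define \<theta> where "\<theta> = (\<lambda>p::'a \<Rightarrow> 'b. (p k, restrict p I))"
  define f :: "'a \<times> 'c \<times> ('a \<Rightarrow> 'b) \<Rightarrow> 'c \<times> ('a \<Rightarrow> 'b) + 'b \<times> 'a \<times> 'c \<times> ('a \<Rightarrow> 'b)"
    where "f = (\<lambda>(i, x, t). if i = k then Inl (x, t) else Inr (t k, i, x, restrict t (I - {i})))"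
  define f' :: "'c \<times> ('a \<Rightarrow> 'b) + 'b \<times> 'a \<times> 'c \<times> ('a \<Rightarrow> 'b) \<Rightarrow> 'a \<times> 'c \<times> ('a \<Rightarrow> 'b)"
    where "f' = case_sum (\<lambda>(x, t). (k, x, t)) (\<lambda>(g, i, x, t). (i, x, t(k := g)))"
  have [simp]: "insert k I - {k} = I" using assms by auto
  have ins: "insert k I - {i} = insert k (I - {i})" "i \<noteq> k" if "i \<in> I" for i
    using that assms by auto
  have "bij_betw \<theta> (carrier (grp (dir_sum (insert k I) A))) (carrier (grp (dir_sum2 (A k) (dir_sum I A))))"
    by (rule bij_betw_byWitness[where f' = "\<lambda>(g, t). t(k := g)"])
      (use assms in \<open>auto simp: dir_sum_def dir_sum2_def Let_def \<theta>_def PiE_iff extensional_def fun_eq_iff restrict_def split: if_splits\<close>)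
  moreover have "\<theta> \<in> hom (grp (dir_sum (insert k I) A)) (grp (dir_sum2 (A k) (dir_sum I A)))"
    using assms
    by (intro homI) (auto simp: dir_sum_def dir_sum2_def Let_def \<theta>_def product_group_def PiE_iff extensional_def fun_eq_iff restrict_def)
  ultimately have "\<theta> \<in> iso (grp (dir_sum (insert k I) A)) (grp (dir_sum2 (A k) (dir_sum I A)))"
    by (simp add: iso_def)
  moreover have "bij_betw f (pts (dir_sum (insert k I) A)) (pts (dir_sum2 (A k) (dir_sum I A)))"
  proof (rule bij_betw_byWitness[where f' = f'])
    have P: "pts (dir_sum J A) = (SIGMA i:J. pts (A i) \<times> (\<Pi>\<^sub>E j\<in>J - {i}. carrier (grp (A j))))" for J
      by (simp add: dir_sum_def Let_def)
    have P2: "pts (dir_sum2 (A k) (dir_sum I A)) =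
        (pts (A k) \<times> (\<Pi>\<^sub>E j\<in>I. carrier (grp (A j)))) <+> (carrier (grp (A k)) \<times> pts (dir_sum I A))"
      by (simp add: dir_sum2_def dir_sum_def Let_def)
    have E1: "(restrict t (I - {i}))(k := t k) = t"
      if "i \<in> I" "t \<in> (\<Pi>\<^sub>E j\<in>insert k I - {i}. carrier (grp (A j)))" for i t
      using that assms by (auto simp: fun_eq_iff PiE_iff extensional_def)
    have E2: "restrict (t(k := g)) (I - {i}) = t"
      if "t \<in> (\<Pi>\<^sub>E j\<in>I - {i}. carrier (grp (A j)))" for i t g
      using that assms by (auto simp: fun_eq_iff PiE_iff extensional_def restrict_def)
    show "\<forall>a\<in>pts (dir_sum (insert k I) A). f' (f a) = a"
      by (auto simp: P f_def f'_def E1)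
    show "\<forall>b\<in>pts (dir_sum2 (A k) (dir_sum I A)). f (f' b) = b"
    proof
      fix b assume "b \<in> pts (dir_sum2 (A k) (dir_sum I A))"
      then consider x t where "b = Inl (x, t)"
        | g i x t where "b = Inr (g, i, x, t)" "i \<in> I" "t \<in> (\<Pi>\<^sub>E j\<in>I - {i}. carrier (grp (A j)))"
        unfolding P P2 by blast
      then show "f (f' b) = b"
        by cases (simp_all add: f_def f'_def E2 ins(2))
    qed
    show "f ` pts (dir_sum (insert k I) A) \<subseteq> pts (dir_sum2 (A k) (dir_sum I A))"
    proof (rule image_subsetI)
      fix b assume "b \<in> pts (dir_sum (insert k I) A)"
      then obtain i x t where b: "b = (i, x, t)" and i: "i \<in> insert k I" and x: "x \<in> pts (A i)"
        and t: "t \<in> (\<Pi>\<^sub>E j\<in>insert k I - {i}. carrier (grp (A j)))"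
        unfolding P by blast
      show "f b \<in> pts (dir_sum2 (A k) (dir_sum I A))"
      proof (cases "i = k")
        case True
        then show ?thesis using x t by (simp add: b f_def P2 InlI)
      next
        case False
        then have "i \<in> I" using i by simp
        moreover from this have "t k \<in> carrier (grp (A k))"
          and "restrict t (I - {i}) \<in> (\<Pi>\<^sub>E j\<in>I - {i}. carrier (grp (A j)))"
          using t unfolding ins(1)[OF \<open>i \<in> I\<close>] by (simp_all add: PiE_iff)
        ultimately show ?thesis using False x by (simp add: b f_def P P2 InrI)
      qed
    qed
    show "f' ` pts (dir_sum2 (A k) (dir_sum I A)) \<subseteq> pts (dir_sum (insert k I) A)"
    proof (rule image_subsetI)
      fix b assume "b \<in> pts (dir_sum2 (A k) (dir_sum I A))"
      then consider x t where "b = Inl (x, t)" "x \<in> pts (A k)" "t \<in> (\<Pi>\<^sub>E j\<in>I. carrier (grp (A j)))"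
        | g i x t where "b = Inr (g, i, x, t)" "g \<in> carrier (grp (A k))" "i \<in> I" "x \<in> pts (A i)"
          "t \<in> (\<Pi>\<^sub>E j\<in>I - {i}. carrier (grp (A j)))"
        unfolding P P2 by blast
      then show "f' b \<in> pts (dir_sum (insert k I) A)"
      proof cases
        case 1
        then show ?thesis by (simp add: f'_def P)
      next
        case 2
        then show ?thesis by (simp add: f'_def P ins(1) fun_upd_in_PiE PiE_fun_upd)
      qed
    qed
  qed
  moreover have "f (gact (dir_sum (insert k I) A) g w) = gact (dir_sum2 (A k) (dir_sum I A)) (\<theta> g) (f w)"
    if "g \<in> carrier (grp (dir_sum (insert k I) A))" and w: "w \<in> pts (dir_sum (insert k I) A)" for g w
  proof -
    obtain i x t where wi: "w = (i, x, t)" by (cases w)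
    show ?thesis
    proof (cases "i = k")
      case True
      then have "x \<in> pts (A k)" "t \<in> (\<Pi>\<^sub>E j\<in>I. carrier (grp (A j)))"
        using w by (auto simp: wi dir_sum_def Let_def)
      then show ?thesis
        using True by (simp add: wi dir_sum_def dir_sum2_def Let_def f_def \<theta>_def product_group_def)
          (auto simp: fun_eq_iff)
    next
      case False
      then have "i \<in> I" using w by (simp add: wi dir_sum_def Let_def)
      then have "x \<in> pts (A i)" and t: "t \<in> (\<Pi>\<^sub>E j\<in>insert k (I - {i}). carrier (grp (A j)))"
        using w unfolding ins(1)[OF \<open>i \<in> I\<close>, symmetric] by (simp_all add: wi dir_sum_def Let_def)
      moreover have "restrict t (I - {i}) \<in> (\<Pi>\<^sub>E j\<in>I - {i}. carrier (grp (A j)))"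
        and "t k \<in> carrier (grp (A k))"
        using t by (simp_all add: PiE_iff)
      ultimately show ?thesis
        using False \<open>i \<in> I\<close> by (simp add: wi dir_sum_def dir_sum2_def Let_def f_def \<theta>_def ins)
          (auto simp: fun_eq_iff PiE_iff split: if_splits)
    qed
  qed
  ultimately show ?thesis by blast
qed

end

theory Submission
  imports Defs
begin

text \<open>A span \<open>D \<leftarrow> U \<rightarrow> X\<close> of \<open>(P \<times> G)\<close>-sets for which \<open>U \<rightarrow> X\<close> is a principal \<open>P\<close>-bundle and
  \<open>U \<rightarrow> D\<close> a principal \<open>G\<close>-bundle is invertible, with the opposite span as inverse: an element
  \<open>[v, u]\<close> of the composite determines the unique \<open>g\<close> with \<open>v = u g\<inverse>\<close>, and \<open>[v, u] \<mapsto> (g, \<alpha> v)\<close> is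
  an isomorphism with the identity span. For \<open>P = \<Prod>\<^sub>j G\<^sub>j\<close> and \<open>D = \<Squnion>\<^sub>i \<Prod>\<^sub>j\<^sub>\<noteq>\<^sub>i G\<^sub>j\<close> such a \<open>U\<close> is
  \<open>\<Squnion>\<^sub>i G \<times> \<Prod>\<^sub>j\<^sub>\<noteq>\<^sub>i G\<^sub>j\<close>, with legs \<open>(g, t) \<mapsto> t\<close> and \<open>(g, t) \<mapsto> g x\<^sub>i\<close>.\<close>

section \<open>Quotients of free abelian groups\<close>

text \<open>Morphisms are cosets on two levels, Burnside group and tensor product, and composition
  on each level is a union over all representatives. To evaluate even one composite, these unions
  must be shown to be single cosets, which means checking that span composition respects
  isomorphisms and disjoint unions in each argument. After that, the morphisms
  \<open>1 \<otimes> [U]\<close> and \<open>1 \<otimes> [U^op]\<close> can be composed at the level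
  of spans. The factor with index \<open>i\<close> is missing from the \<open>i\<close>-th piece of
  \<open>D\<close> because \<open>G_i\<close> acts on \<open>G\<close> instead: the fibre of
  \<open>U\<close> over \<open>g x_i\<close> is \<open>g G_i\<close> times the product of the other
  \<open>G_j\<close>, so each factor of \<open>P\<close> acts simply transitively on exactly one
  factor of the fibre. Hence the one group \<open>P\<close> is simply transitive on the fibres over
  all orbits, although their stabilizers differ, and a single span compares \<open>X/G\<close> with
  the whole direct sum, without induction on \<open>n\<close>.\<close>

lemma r_coset_free_Abelian_group:
  "N #>\<^bsub>free_Abelian_group S\<^esub> x = (\<lambda>n. n + x) ` N"
  by (auto simp: r_coset_def)

lemma generate_free_Abelian_group_subgroup:
  assumes "Rel \<subseteq> carrier (free_Abelian_group S)"
  shows "subgroup (generate (free_Abelian_group S) Rel) (free_Abelian_group S)"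
  using group.generate_is_subgroup[OF group_free_Abelian_group assms] .

lemma subgroup_free_Abelian_groupD:
  assumes "subgroup N (free_Abelian_group S)"
  shows "0 \<in> N" "a \<in> N \<Longrightarrow> b \<in> N \<Longrightarrow> a + b \<in> N" "a \<in> N \<Longrightarrow> - a \<in> N" "a \<in> N \<Longrightarrow> b \<in> N \<Longrightarrow> a - b \<in> N"
    "a \<in> N \<Longrightarrow> Poly_Mapping.keys a \<subseteq> S"
proof -
  \<comment> \<open>This comes first because the group inverse is known to be \<open>- a\<close>
    only for \<open>a\<close> supported in \<open>S\<close>.\<close>
  show keys: "Poly_Mapping.keys a \<subseteq> S" if "a \<in> N" for a
    using subsetD[OF subgroup.subset[OF assms] that] by simp
  show "0 \<in> N" using subgroup.one_closed[OF assms] by simp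
  show add: "a + b \<in> N" if "a \<in> N" "b \<in> N" for a b
    using subgroup.m_closed[OF assms that] by simp
  show minus: "- a \<in> N" if "a \<in> N" for a
    using subgroup.m_inv_closed[OF assms that] keys[OF that] by simp
  show "a - b \<in> N" if "a \<in> N" "b \<in> N" for a b
    using add[OF that(1) minus[OF that(2)]] by simp
qed

lemma r_coset_free_Abelian_group_eqI:
  assumes N: "subgroup N (free_Abelian_group S)" and "x - y \<in> N"
  shows "N #>\<^bsub>free_Abelian_group S\<^esub> x = N #>\<^bsub>free_Abelian_group S\<^esub> y"
proof -
  have "n + x \<in> (\<lambda>n. n + y) ` N" if "n \<in> N" for n
    using subgroup_free_Abelian_groupD(2)[OF N that assms(2)]
    by (intro image_eqI[of _ _ "n + (x - y)"]) (auto simp: algebra_simps)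
  moreover have "n + y \<in> (\<lambda>n. n + x) ` N" if "n \<in> N" for n
    using subgroup_free_Abelian_groupD(4)[OF N that assms(2)]
    by (intro image_eqI[of _ _ "n - (x - y)"]) (auto simp: algebra_simps)
  ultimately show ?thesis by (auto simp: r_coset_free_Abelian_group)
qed

text \<open>The map \<open>frag_extend h\<close> is additive, so the preimage of \<open>N\<close> is
  closed under sums and negatives and only relators need to be inspected.\<close>

lemma frag_extend_generate:
  assumes Rel: "Rel \<subseteq> carrier (free_Abelian_group S)"
    and N: "subgroup N (free_Abelian_group T)"
    and h: "\<And>r. r \<in> Rel \<Longrightarrow> frag_extend h r \<in> N"
    and x: "x \<in> generate (free_Abelian_group S) Rel"
  shows "frag_extend h x \<in> N"
  using x
proof (induction rule: generate.induct)
  case one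
  then show ?case using subgroup_free_Abelian_groupD(1)[OF N] by simp
next
  case (incl r)
  then show ?case by (rule h)
next
  case (inv r)
  then have "inv\<^bsub>free_Abelian_group S\<^esub> r = - r"
    using subsetD[OF Rel] by (intro inv_free_Abelian_group) simp
  then show ?case
    using subgroup_free_Abelian_groupD(3)[OF N h[OF inv]] by (simp add: frag_extend_minus)
next
  case (eng a b)
  then show ?case
    using subgroup_free_Abelian_groupD(2)[OF N] by (simp add: frag_extend_add)
qed

section \<open>Biadditive extension from pairs of generators\<close>

lemma frag_extend_diff_fun:
  "frag_extend (\<lambda>u. p u - q u) c = frag_extend p c - frag_extend q c"
proof -
  have "Poly_Mapping.keys c \<subseteq> UNIV" by simp
  then show ?thesis by (induction c rule: frag_induction) (simp_all add: frag_extend_diff)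
qed

text \<open>The nesting is that of \<open>burnside_comp_def\<close> and \<open>cr_comp_def\<close>,
  so one well-definedness argument serves both levels.\<close>

definition frag_extend2 :: "('a \<Rightarrow> 'b \<Rightarrow> 'c \<Rightarrow>\<^sub>0 int) \<Rightarrow> ('a \<Rightarrow>\<^sub>0 int) \<Rightarrow> ('b \<Rightarrow>\<^sub>0 int) \<Rightarrow> 'c \<Rightarrow>\<^sub>0 int" where
  "frag_extend2 f d c = frag_extend (\<lambda>v. frag_extend (f v) c) d"

lemma frag_extend2_add_left: "frag_extend2 f (d + d') c = frag_extend2 f d c + frag_extend2 f d' c"
  by (simp add: frag_extend2_def frag_extend_add)

lemma frag_extend2_diff_left: "frag_extend2 f (d - d') c = frag_extend2 f d c - frag_extend2 f d' c"
  by (simp add: frag_extend2_def frag_extend_diff)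

lemma frag_extend2_zero_left [simp]: "frag_extend2 f 0 c = 0"
  by (simp add: frag_extend2_def)

lemma frag_extend2_of [simp]: "frag_extend2 f (frag_of v) (frag_of u) = f v u"
  by (simp add: frag_extend2_def)

text \<open>Both sides are additive in \<open>d\<close> and agree on generators. The exchange
  transfers facts about the left argument to the right one, where the nesting hides
  additivity.\<close>

lemma frag_extend2_swap: "frag_extend2 f d c = frag_extend2 (\<lambda>u v. f v u) c d"
proof -
  have "Poly_Mapping.keys d \<subseteq> UNIV" by simp
  then show ?thesis
  proof (induction d rule: frag_induction)
    case zero
    then show ?case by (simp add: frag_extend2_def frag_extend_eq_0)
  next
    case (one v)
    then show ?case by (simp add: frag_extend2_def)
  next
    case (diff a b)
    then show ?case by (simp add: frag_extend2_def frag_extend_diff frag_extend_diff_fun)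
  qed
qed

lemma frag_extend2_add_right: "frag_extend2 f d (c + c') = frag_extend2 f d c + frag_extend2 f d c'"
  using frag_extend2_add_left[of "\<lambda>u v. f v u"] by (simp add: frag_extend2_swap[of f])

lemma frag_extend2_diff_right: "frag_extend2 f d (c - c') = frag_extend2 f d c - frag_extend2 f d c'"
  using frag_extend2_diff_left[of "\<lambda>u v. f v u"] by (simp add: frag_extend2_swap[of f])

lemma keys_frag_extend2:
  assumes "\<And>v u. v \<in> S \<Longrightarrow> u \<in> T \<Longrightarrow> Poly_Mapping.keys (f v u) \<subseteq> W"
    and "Poly_Mapping.keys d \<subseteq> S" "Poly_Mapping.keys c \<subseteq> T"
  shows "Poly_Mapping.keys (frag_extend2 f d c) \<subseteq> W"
proof -
  have "Poly_Mapping.keys (frag_extend (f v) c) \<subseteq> W" if "v \<in> S" for v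
    using keys_frag_extend[of "f v" c] assms(1)[OF that] assms(3) by blast
  then show ?thesis
    using keys_frag_extend[of "\<lambda>v. frag_extend (f v) c" d] assms(2)
    unfolding frag_extend2_def by blast
qed

text \<open>Relators are tested against single generators \<open>u\<close> only. Induction on
  \<open>c\<close> extends this to all \<open>c\<close>, since \<open>N\<close> is closed under
  differences.\<close>

lemma frag_extend2_generate_left:
  assumes Rel: "Rel \<subseteq> carrier (free_Abelian_group S)"
    and N: "subgroup N (free_Abelian_group W)"
    and f: "\<And>r u. r \<in> Rel \<Longrightarrow> u \<in> T \<Longrightarrow> frag_extend (\<lambda>v. f v u) r \<in> N"
    and x: "x \<in> generate (free_Abelian_group S) Rel"
    and c: "Poly_Mapping.keys c \<subseteq> T"
  shows "frag_extend2 f x c \<in> N"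
  using c
proof (induction c rule: frag_induction)
  case zero
  then show ?case using subgroup_free_Abelian_groupD(1)[OF N] by (simp add: frag_extend2_swap[of f])
next
  case (one u)
  then show ?case
    using frag_extend_generate[OF Rel N f x] by (simp add: frag_extend2_def)
next
  case (diff a b)
  then show ?case using subgroup_free_Abelian_groupD(4)[OF N] by (simp add: frag_extend2_diff_right)
qed

text \<open>By biadditivity, changing the representatives \<open>d\<close>, \<open>c\<close> to
  \<open>m + d\<close>, \<open>n + c\<close> changes the value by
  \<open>frag_extend2 f m (n + c) + frag_extend2 f d n\<close>. Each summand has a relation in one
  argument, so all representatives give the same coset.\<close>

lemma frag_extend2_cosets:
  assumes S: "RelS \<subseteq> carrier (free_Abelian_group S)" and T: "RelT \<subseteq> carrier (free_Abelian_group T)"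
    and N: "subgroup N (free_Abelian_group W)"
    and fS: "\<And>r u. r \<in> RelS \<Longrightarrow> u \<in> T \<Longrightarrow> frag_extend (\<lambda>v. f v u) r \<in> N"
    and fT: "\<And>r v. r \<in> RelT \<Longrightarrow> v \<in> S \<Longrightarrow> frag_extend (f v) r \<in> N"
    and d: "Poly_Mapping.keys d \<subseteq> S" and c: "Poly_Mapping.keys c \<subseteq> T"
  shows "(\<Union>d'\<in>generate (free_Abelian_group S) RelS #>\<^bsub>free_Abelian_group S\<^esub> d.
           \<Union>c'\<in>generate (free_Abelian_group T) RelT #>\<^bsub>free_Abelian_group T\<^esub> c.
             N #>\<^bsub>free_Abelian_group W\<^esub> frag_extend2 f d' c')
         = N #>\<^bsub>free_Abelian_group W\<^esub> frag_extend2 f d c" (is "?L = ?R")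
proof -
  let ?NS = "generate (free_Abelian_group S) RelS" and ?NT = "generate (free_Abelian_group T) RelT"
  note NS = subgroup_free_Abelian_groupD[OF generate_free_Abelian_group_subgroup[OF S]]
  note NT = subgroup_free_Abelian_groupD[OF generate_free_Abelian_group_subgroup[OF T]]
  have eq: "N #>\<^bsub>free_Abelian_group W\<^esub> frag_extend2 f (m + d) (n + c) = ?R"
    if m: "m \<in> ?NS" and n: "n \<in> ?NT" for m n
  proof (rule r_coset_free_Abelian_group_eqI[OF N])
    have "Poly_Mapping.keys (n + c) \<subseteq> T" using NT(5)[OF n] c keys_add[of n c] by blast
    from frag_extend2_generate_left[OF S N _ m this] have "frag_extend2 f m (n + c) \<in> N"
      using fS .
    moreover have "frag_extend2 f d n \<in> N"
      unfolding frag_extend2_swap[of f]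
      by (rule frag_extend2_generate_left[where T = S, OF T N _ n d]) (rule fT)
    ultimately have "frag_extend2 f m (n + c) + frag_extend2 f d n \<in> N"
      by (rule subgroup_free_Abelian_groupD(2)[OF N])
    then show "frag_extend2 f (m + d) (n + c) - frag_extend2 f d c \<in> N"
      by (simp add: frag_extend2_add_left frag_extend2_add_right add_ac)
  qed
  have "?L = (\<Union>m\<in>?NS. \<Union>n\<in>?NT. N #>\<^bsub>free_Abelian_group W\<^esub> frag_extend2 f (m + d) (n + c))"
    by (simp add: r_coset_free_Abelian_group)
  also have "\<dots> = (\<Union>m\<in>?NS. \<Union>n\<in>?NT. ?R)" using eq by (intro SUP_cong refl) 
  \<comment> \<open>The unions run over nonempty sets, because \<open>0\<close> lies in both
    relation subgroups.\<close>
  also have "\<dots> = ?R" using NS(1) NT(1) by auto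
  finally show ?thesis .
qed

section \<open>Finite sets over a base\<close>

text \<open>Members of \<open>BijGroup E\<close> are extensional, which is why \<open>ext\<close> is
  demanded. Bijectivity is free: \<open>inv g\<close> acts as a two-sided inverse of
  \<open>g\<close>.\<close>

lemma group_actionI:
  assumes G: "group G"
    and ext: "\<And>g. g \<in> carrier G \<Longrightarrow> f g \<in> extensional E"
    and closed: "\<And>g x. g \<in> carrier G \<Longrightarrow> x \<in> E \<Longrightarrow> f g x \<in> E"
    and one: "\<And>x. x \<in> E \<Longrightarrow> f \<one>\<^bsub>G\<^esub> x = x"
    and mult: "\<And>g h x. g \<in> carrier G \<Longrightarrow> h \<in> carrier G \<Longrightarrow> x \<in> E \<Longrightarrow> f (g \<otimes>\<^bsub>G\<^esub> h) x = f g (f h x)"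
  shows "group_action G E f"
proof -
  interpret G: group G by (rule G)
  have Bij: "f g \<in> Bij E" if g: "g \<in> carrier G" for g
  proof -
    have "f (inv\<^bsub>G\<^esub> g) (f g x) = x" "f g (f (inv\<^bsub>G\<^esub> g) x) = x" if "x \<in> E" for x
      using that g mult[of "inv\<^bsub>G\<^esub> g" g x] mult[of g "inv\<^bsub>G\<^esub> g" x] by (simp_all add: one)
    then have "bij_betw (f g) E E"
      using g closed by (intro bij_betw_byWitness[where f' = "f (inv\<^bsub>G\<^esub> g)"]) auto
    then show ?thesis using ext[OF g] by (simp add: Bij_def)
  qed
  have "f \<in> hom G (BijGroup E)"
  proof (rule homI)
    fix g h assume gh: "g \<in> carrier G" "h \<in> carrier G"
    show "f (g \<otimes>\<^bsub>G\<^esub> h) = f g \<otimes>\<^bsub>BijGroup E\<^esub> f h"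
    proof
      fix x
      show "f (g \<otimes>\<^bsub>G\<^esub> h) x = (f g \<otimes>\<^bsub>BijGroup E\<^esub> f h) x"
        using gh ext[of "g \<otimes>\<^bsub>G\<^esub> h"] mult
        by (cases "x \<in> E") (auto simp: BijGroup_def Bij compose_def extensional_def)
    qed
  qed (simp add: BijGroup_def Bij)
  then show ?thesis
    by (intro group_action.intro group_hom.intro group_hom_axioms.intro G group_BijGroup)
qed

lemma gset_overI:
  assumes "group (grp Z)" and "finite (tot S)"
    and "\<And>p. p \<in> carrier (grp Z) \<Longrightarrow> act S p \<in> extensional (tot S)"
    and "\<And>p u. p \<in> carrier (grp Z) \<Longrightarrow> u \<in> tot S \<Longrightarrow> act S p u \<in> tot S"
    and "\<And>u. u \<in> tot S \<Longrightarrow> act S \<one>\<^bsub>grp Z\<^esub> u = u"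
    and "\<And>p q u. p \<in> carrier (grp Z) \<Longrightarrow> q \<in> carrier (grp Z) \<Longrightarrow> u \<in> tot S \<Longrightarrow>
           act S (p \<otimes>\<^bsub>grp Z\<^esub> q) u = act S p (act S q u)"
    and "\<And>u. u \<in> tot S \<Longrightarrow> proj S u \<in> pts Z"
    and "\<And>p u. p \<in> carrier (grp Z) \<Longrightarrow> u \<in> tot S \<Longrightarrow> proj S (act S p u) = gact Z p (proj S u)"
  shows "gset_over Z S"
  using assms unfolding gset_over_def by (auto intro!: group_actionI)

lemma gset_overD:
  assumes "gset_over Z S"
  shows "group (grp Z)" "finite (tot S)"
    "p \<in> carrier (grp Z) \<Longrightarrow> act S p \<in> extensional (tot S)"
    "p \<in> carrier (grp Z) \<Longrightarrow> u \<in> tot S \<Longrightarrow> act S p u \<in> tot S"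
    "u \<in> tot S \<Longrightarrow> act S \<one>\<^bsub>grp Z\<^esub> u = u"
    "p \<in> carrier (grp Z) \<Longrightarrow> q \<in> carrier (grp Z) \<Longrightarrow> u \<in> tot S \<Longrightarrow>
           act S (p \<otimes>\<^bsub>grp Z\<^esub> q) u = act S p (act S q u)"
    "u \<in> tot S \<Longrightarrow> proj S u \<in> pts Z"
    "p \<in> carrier (grp Z) \<Longrightarrow> u \<in> tot S \<Longrightarrow> proj S (act S p u) = gact Z p (proj S u)"
proof -
  interpret group_action "grp Z" "tot S" "act S" using assms by (simp add: gset_over_def)
  show "group (grp Z)" using group_hom group_hom.axioms(1) by blast
  show "finite (tot S)" using assms by (simp add: gset_over_def)
  show "p \<in> carrier (grp Z) \<Longrightarrow> act S p \<in> extensional (tot S)" using bij_prop0 by (simp add: Bij_def)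
  show "p \<in> carrier (grp Z) \<Longrightarrow> u \<in> tot S \<Longrightarrow> act S p u \<in> tot S" using element_image by blast
  show "u \<in> tot S \<Longrightarrow> act S \<one>\<^bsub>grp Z\<^esub> u = u" by (simp add: id_eq_one[symmetric])
  show "p \<in> carrier (grp Z) \<Longrightarrow> q \<in> carrier (grp Z) \<Longrightarrow> u \<in> tot S \<Longrightarrow>
           act S (p \<otimes>\<^bsub>grp Z\<^esub> q) u = act S p (act S q u)" by (rule composition_rule)
  show "u \<in> tot S \<Longrightarrow> proj S u \<in> pts Z" using assms by (auto simp: gset_over_def)
  show "p \<in> carrier (grp Z) \<Longrightarrow> u \<in> tot S \<Longrightarrow> proj S (act S p u) = gact Z p (proj S u)"
    using assms by (simp add: gset_over_def)
qed

lemma gset_over_transport: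
  assumes S: "gset_over Z S" and f: "bij_betw f (tot S) (tot T)"
    and ext: "\<And>p. p \<in> carrier (grp Z) \<Longrightarrow> act T p \<in> extensional (tot T)"
    and act: "\<And>p u. p \<in> carrier (grp Z) \<Longrightarrow> u \<in> tot S \<Longrightarrow> act T p (f u) = f (act S p u)"
    and proj: "\<And>u. u \<in> tot S \<Longrightarrow> proj T (f u) = proj S u"
  shows "gset_over Z T"
proof -
  note S' = gset_overD[OF S]
  interpret group "grp Z" by (rule S')
  have tot: "tot T = f ` tot S" using f by (simp add: bij_betw_def)
  show ?thesis
    by (rule gset_overI; (rule ext, assumption)?) (auto simp: tot act proj S'(1,2,4-8))
qed

lemma over_iso_refl: "over_iso Z S S"
  unfolding over_iso_def by (intro exI[of _ id]) auto

text \<open>Equivariance of the inverse map cancels \<open>f\<close> at \<open>act S p u\<close>,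
  which must therefore lie in \<open>tot S\<close>; this is what the hypothesis on \<open>S\<close>
  provides.\<close>

lemma over_iso_sym:
  assumes S: "gset_over Z S" and "over_iso Z S T"
  shows "over_iso Z T S"
proof -
  obtain f where f: "bij_betw f (tot S) (tot T)"
    and act: "\<And>p u. p \<in> carrier (grp Z) \<Longrightarrow> u \<in> tot S \<Longrightarrow> f (act S p u) = act T p (f u)"
    and proj: "\<And>u. u \<in> tot S \<Longrightarrow> proj T (f u) = proj S u"
    using assms(2) unfolding over_iso_def by blast
  define g where "g = the_inv_into (tot S) f"
  have inj: "inj_on f (tot S)" and tot: "tot T = f ` tot S" using f by (auto simp: bij_betw_def)
  have gf: "g (f u) = u" if "u \<in> tot S" for u
    using the_inv_into_f_f[OF inj that] by (simp add: g_def)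
  show ?thesis unfolding over_iso_def
  proof (intro exI[of _ g] conjI ballI)
    show "bij_betw g (tot T) (tot S)" unfolding g_def by (rule bij_betw_the_inv_into[OF f])
  next
    fix p v assume p: "p \<in> carrier (grp Z)" and "v \<in> tot T"
    then obtain u where u: "u \<in> tot S" "v = f u" using tot by auto
    then have "act T p v = f (act S p u)" using act p by simp
    then show "g (act T p v) = act S p (g v)" using u p gset_overD(4)[OF S] by (simp add: gf)
  next
    fix v assume "v \<in> tot T"
    then show "proj S (g v) = proj T v" using tot by (auto simp: gf proj)
  qed
qed

lemma over_iso_trans:
  assumes "over_iso Z S T" "over_iso Z T W"
  shows "over_iso Z S W"
proof -
  obtain f where f: "bij_betw f (tot S) (tot T)"
    "\<forall>p \<in> carrier (grp Z). \<forall>u \<in> tot S. f (act S p u) = act T p (f u)"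
    "\<forall>u \<in> tot S. proj T (f u) = proj S u"
    using assms(1) unfolding over_iso_def by blast
  obtain g where g: "bij_betw g (tot T) (tot W)"
    "\<forall>p \<in> carrier (grp Z). \<forall>u \<in> tot T. g (act T p u) = act W p (g u)"
    "\<forall>u \<in> tot T. proj W (g u) = proj T u"
    using assms(2) unfolding over_iso_def by blast
  have "f u \<in> tot T" if "u \<in> tot S" for u using f(1) that by (rule bij_betwE[THEN bspec])
  then show ?thesis unfolding over_iso_def using f g
    by (intro exI[of _ "g \<circ> f"]) (auto intro: bij_betw_trans)
qed

lemma nat_copy_simps:
  assumes "finite (tot S)"
  shows "bij_betw (to_nat_on (tot S)) (tot S) (tot (nat_copy S))"
    and "act (nat_copy S) p \<in> extensional (tot (nat_copy S))"
    and "u \<in> tot S \<Longrightarrow> act (nat_copy S) p (to_nat_on (tot S) u) = to_nat_on (tot S) (act S p u)"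
    and "u \<in> tot S \<Longrightarrow> proj (nat_copy S) (to_nat_on (tot S) u) = proj S u"
  using countable_finite[OF assms] by (auto simp: nat_copy_def Let_def bij_betw_def)

lemma gset_over_nat_copy:
  assumes "gset_over Z S" shows "gset_over Z (nat_copy S)"
  using nat_copy_simps[OF gset_overD(2)[OF assms]]
  by (intro gset_over_transport[OF assms]) auto

lemma over_iso_nat_copy:
  assumes "finite (tot S)" shows "over_iso Z S (nat_copy S)"
  unfolding over_iso_def using nat_copy_simps[OF assms]
  by (intro exI[of _ "to_nat_on (tot S)"]) auto

lemma over_iso_nat_copy_cong:
  assumes "gset_over Z S" "gset_over Z T" "over_iso Z S T"
  shows "over_iso Z (nat_copy S) (nat_copy T)"
proof -
  have "over_iso Z (nat_copy S) S"
    by (rule over_iso_sym[OF assms(1) over_iso_nat_copy[OF gset_overD(2)[OF assms(1)]]])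
  then show ?thesis
    by (rule over_iso_trans[OF over_iso_trans[OF _ assms(3)] over_iso_nat_copy[OF gset_overD(2)[OF assms(2)]]])
qed

lemma gset_over_over_sum:
  assumes S: "gset_over Z S" and T: "gset_over Z T"
  shows "gset_over Z (over_sum S T)"
proof -
  note S' = gset_overD[OF S] and T' = gset_overD[OF T]
  interpret group "grp Z" by (rule S')
  show ?thesis
    by (rule gset_overI)
      (auto simp: over_sum_def S'(1,2,4-8) T'(2,4-8))
qed

lemma over_iso_over_sum:
  assumes "over_iso Z S S'" "over_iso Z T T'"
    and S: "gset_over Z S" and T: "gset_over Z T"
  shows "over_iso Z (over_sum S T) (over_sum S' T')"
proof -
  obtain f where f: "bij_betw f (tot S) (tot S')"
    "\<forall>p \<in> carrier (grp Z). \<forall>u \<in> tot S. f (act S p u) = act S' p (f u)"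
    "\<forall>u \<in> tot S. proj S' (f u) = proj S u"
    using assms(1) unfolding over_iso_def by blast
  obtain g where g: "bij_betw g (tot T) (tot T')"
    "\<forall>p \<in> carrier (grp Z). \<forall>u \<in> tot T. g (act T p u) = act T' p (g u)"
    "\<forall>u \<in> tot T. proj T' (g u) = proj T u"
    using assms(2) unfolding over_iso_def by blast
  have fu: "f u \<in> tot S'" if "u \<in> tot S" for u using f(1) that by (rule bij_betwE[THEN bspec])
  have gu: "g u \<in> tot T'" if "u \<in> tot T" for u using g(1) that by (rule bij_betwE[THEN bspec])
  have img: "map_sum f g ` (tot S <+> tot T) = tot S' <+> tot T'"
  proof -
    have "map_sum f g ` (tot S <+> tot T) = f ` tot S <+> g ` tot T" by force
    then show ?thesis by (simp add: bij_betw_imp_surj_on[OF f(1)] bij_betw_imp_surj_on[OF g(1)])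
  qed
  have inj: "inj_on (map_sum f g) (tot S <+> tot T)"
  proof (rule inj_onI)
    fix v w assume "v \<in> tot S <+> tot T" "w \<in> tot S <+> tot T" "map_sum f g v = map_sum f g w"
    then show "v = w"
      by (cases v; cases w)
        (auto dest: inj_onD[OF bij_betw_imp_inj_on[OF f(1)]] inj_onD[OF bij_betw_imp_inj_on[OF g(1)]])
  qed
  show ?thesis unfolding over_iso_def
  proof (intro exI[of _ "map_sum f g"] conjI ballI)
    show "bij_betw (map_sum f g) (tot (over_sum S T)) (tot (over_sum S' T'))"
      using img inj by (simp add: bij_betw_def over_sum_def)
  next
    fix p w assume p: "p \<in> carrier (grp Z)" and "w \<in> tot (over_sum S T)"
    then consider u where "w = Inl u" "u \<in> tot S" | u where "w = Inr u" "u \<in> tot T"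
      by (auto simp: over_sum_def)
    then show "map_sum f g (act (over_sum S T) p w) = act (over_sum S' T') p (map_sum f g w)"
      by cases (use p f(2) g(2) in \<open>simp_all add: over_sum_def fu gu InlI InrI\<close>)
  next
    fix w assume "w \<in> tot (over_sum S T)"
    then consider u where "w = Inl u" "u \<in> tot S" | u where "w = Inr u" "u \<in> tot T"
      by (auto simp: over_sum_def)
    then show "proj (over_sum S' T') (map_sum f g w) = proj (over_sum S T) w"
      by cases (use f(3) g(3) in \<open>simp_all add: over_sum_def\<close>)
  qed
qed

section \<open>Relations of the Burnside group\<close>

abbreviation burnside_gens :: "('p, 'z) gset \<Rightarrow> (('p, nat, 'z) slice \<Rightarrow>\<^sub>0 int) set" where
  "burnside_gens Z \<equiv>
     {frag_of S - frag_of T |S T. gset_over Z S \<and> gset_over Z T \<and> over_iso Z S T} \<union>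
     {frag_of (nat_copy (over_sum S T)) - frag_of S - frag_of T |S T.
        gset_over Z S \<and> gset_over Z T}"

lemma burnside_gens_subset: "burnside_gens Z \<subseteq> carrier (burnside_free Z)"
proof -
  have "frag_of S - frag_of T \<in> carrier (burnside_free Z)" if "gset_over Z S" "gset_over Z T" for S T
    using that keys_diff[of "frag_of S" "frag_of T"] by auto
  moreover have "frag_of (nat_copy (over_sum S T)) - frag_of S - frag_of T \<in> carrier (burnside_free Z)"
    if "gset_over Z S" "gset_over Z T" for S T
    using that gset_over_nat_copy[OF gset_over_over_sum[OF that]]
      keys_diff[of "frag_of (nat_copy (over_sum S T)) - frag_of S" "frag_of T"]
      keys_diff[of "frag_of (nat_copy (over_sum S T))" "frag_of S"] by auto
  ultimately show ?thesis by blast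
qed

lemma subgroup_burnside_rel: "subgroup (burnside_rel Z) (burnside_free Z)"
  unfolding burnside_rel_def by (rule generate_free_Abelian_group_subgroup[OF burnside_gens_subset])

lemma burnside_rel_iso:
  assumes "gset_over Z S" "gset_over Z T" "over_iso Z S T"
  shows "frag_of (nat_copy S) - frag_of (nat_copy T) \<in> burnside_rel Z"
  unfolding burnside_rel_def
  by (rule generate.incl) (use gset_over_nat_copy[OF assms(1)] gset_over_nat_copy[OF assms(2)] over_iso_nat_copy_cong[OF assms] in blast)

lemma over_class_eqI:
  assumes "gset_over Z S" "gset_over Z T" "over_iso Z S T"
  shows "over_class Z S = over_class Z T"
  unfolding over_class_def
  by (rule r_coset_free_Abelian_group_eqI[OF subgroup_burnside_rel burnside_rel_iso[OF assms]])

text \<open>The defining relations only know summands that live on natural numbers. For summands of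
  any type and any model \<open>W\<close> of their sum, the relation telescopes through the copy of
  the sum of the two copies.\<close>

lemma burnside_rel_sum:
  assumes W: "gset_over Z W" and S: "gset_over Z S" and T: "gset_over Z T"
    and iso: "over_iso Z W (over_sum S T)"
  shows "frag_of (nat_copy W) - frag_of (nat_copy S) - frag_of (nat_copy T) \<in> burnside_rel Z"
proof -
  let ?C = "over_sum (nat_copy S) (nat_copy T)"
  have "over_iso Z (over_sum S T) ?C"
    by (rule over_iso_over_sum[OF _ _ S T]) (simp_all add: over_iso_nat_copy gset_overD(2)[OF S] gset_overD(2)[OF T])
  then have "frag_of (nat_copy W) - frag_of (nat_copy ?C) \<in> burnside_rel Z"
    by (intro burnside_rel_iso W gset_over_over_sum gset_over_nat_copy S T over_iso_trans[OF iso])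
  moreover have "frag_of (nat_copy ?C) - frag_of (nat_copy S) - frag_of (nat_copy T) \<in> burnside_rel Z"
    unfolding burnside_rel_def
    by (rule generate.incl) (use gset_over_nat_copy[OF S] gset_over_nat_copy[OF T] in blast)
  ultimately have "(frag_of (nat_copy W) - frag_of (nat_copy ?C)) +
      (frag_of (nat_copy ?C) - frag_of (nat_copy S) - frag_of (nat_copy T)) \<in> burnside_rel Z"
    by (rule subgroup_free_Abelian_groupD(2)[OF subgroup_burnside_rel])
  then show ?thesis by (simp add: add_diff_eq)
qed

section \<open>Composition of spans\<close>

lemma gset_over_ext_prodI:
  assumes "group (grp B)" "group (grp A)" and "finite (tot U)"
    and "\<And>h g. h \<in> carrier (grp B) \<Longrightarrow> g \<in> carrier (grp A) \<Longrightarrow> act U (h, g) \<in> extensional (tot U)"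
    and "\<And>h g u. h \<in> carrier (grp B) \<Longrightarrow> g \<in> carrier (grp A) \<Longrightarrow> u \<in> tot U \<Longrightarrow>
           act U (h, g) u \<in> tot U"
    and "\<And>u. u \<in> tot U \<Longrightarrow> act U (\<one>\<^bsub>grp B\<^esub>, \<one>\<^bsub>grp A\<^esub>) u = u"
    and "\<And>h g h' g' u. h \<in> carrier (grp B) \<Longrightarrow> g \<in> carrier (grp A) \<Longrightarrow>
           h' \<in> carrier (grp B) \<Longrightarrow> g' \<in> carrier (grp A) \<Longrightarrow> u \<in> tot U \<Longrightarrow>
           act U (h \<otimes>\<^bsub>grp B\<^esub> h', g \<otimes>\<^bsub>grp A\<^esub> g') u = act U (h, g) (act U (h', g') u)"
    and "\<And>u. u \<in> tot U \<Longrightarrow> fst (proj U u) \<in> pts B"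
    and "\<And>u. u \<in> tot U \<Longrightarrow> snd (proj U u) \<in> pts A"
    and "\<And>h g u. h \<in> carrier (grp B) \<Longrightarrow> g \<in> carrier (grp A) \<Longrightarrow> u \<in> tot U \<Longrightarrow>
           fst (proj U (act U (h, g) u)) = gact B h (fst (proj U u))"
    and "\<And>h g u. h \<in> carrier (grp B) \<Longrightarrow> g \<in> carrier (grp A) \<Longrightarrow> u \<in> tot U \<Longrightarrow>
           snd (proj U (act U (h, g) u)) = gact A g (snd (proj U u))"
  shows "gset_over (ext_prod B A) U"
  by (rule gset_overI)
    (use assms in \<open>auto simp: ext_prod_def DirProd_group mem_Times_iff prod_eq_iff\<close>)

lemma gset_over_ext_prodD:
  assumes "gset_over (ext_prod B A) U"
  shows "finite (tot U)"
    "h \<in> carrier (grp B) \<Longrightarrow> g \<in> carrier (grp A) \<Longrightarrow> act U (h, g) \<in> extensional (tot U)"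
    "h \<in> carrier (grp B) \<Longrightarrow> g \<in> carrier (grp A) \<Longrightarrow> u \<in> tot U \<Longrightarrow> act U (h, g) u \<in> tot U"
    "u \<in> tot U \<Longrightarrow> act U (\<one>\<^bsub>grp B\<^esub>, \<one>\<^bsub>grp A\<^esub>) u = u"
    "h \<in> carrier (grp B) \<Longrightarrow> g \<in> carrier (grp A) \<Longrightarrow>
       h' \<in> carrier (grp B) \<Longrightarrow> g' \<in> carrier (grp A) \<Longrightarrow> u \<in> tot U \<Longrightarrow>
       act U (h, g) (act U (h', g') u) = act U (h \<otimes>\<^bsub>grp B\<^esub> h', g \<otimes>\<^bsub>grp A\<^esub> g') u"
    "u \<in> tot U \<Longrightarrow> fst (proj U u) \<in> pts B"
    "u \<in> tot U \<Longrightarrow> snd (proj U u) \<in> pts A"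
    "h \<in> carrier (grp B) \<Longrightarrow> g \<in> carrier (grp A) \<Longrightarrow> u \<in> tot U \<Longrightarrow>
       fst (proj U (act U (h, g) u)) = gact B h (fst (proj U u))"
    "h \<in> carrier (grp B) \<Longrightarrow> g \<in> carrier (grp A) \<Longrightarrow> u \<in> tot U \<Longrightarrow>
       snd (proj U (act U (h, g) u)) = gact A g (snd (proj U u))"
proof -
  note U = gset_overD[OF assms, unfolded ext_prod_def, simplified]
  have pts: "fst (proj U u) \<in> pts B \<and> snd (proj U u) \<in> pts A" if "u \<in> tot U" for u
    using U(7)[OF that] by (simp add: mem_Times_iff)
  have "proj U (act U (h, g) u) = (gact B h (fst (proj U u)), gact A g (snd (proj U u)))"
    if "h \<in> carrier (grp B)" "g \<in> carrier (grp A)" "u \<in> tot U" for h g u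
    using U(8)[of "(h, g)" u] that pts[OF that(3)]
    by (simp add: mem_Times_iff map_prod_def split_beta)
  then show "h \<in> carrier (grp B) \<Longrightarrow> g \<in> carrier (grp A) \<Longrightarrow> u \<in> tot U \<Longrightarrow>
       fst (proj U (act U (h, g) u)) = gact B h (fst (proj U u))"
    "h \<in> carrier (grp B) \<Longrightarrow> g \<in> carrier (grp A) \<Longrightarrow> u \<in> tot U \<Longrightarrow>
       snd (proj U (act U (h, g) u)) = gact A g (snd (proj U u))"
    by simp_all
  show "h \<in> carrier (grp B) \<Longrightarrow> g \<in> carrier (grp A) \<Longrightarrow>
       h' \<in> carrier (grp B) \<Longrightarrow> g' \<in> carrier (grp A) \<Longrightarrow> u \<in> tot U \<Longrightarrow>
       act U (h, g) (act U (h', g') u) = act U (h \<otimes>\<^bsub>grp B\<^esub> h', g \<otimes>\<^bsub>grp A\<^esub> g') u"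
    using U(6)[of "(h, g)" "(h', g')" u] by simp
qed (use gset_overD[OF assms, unfolded ext_prod_def, simplified] in \<open>auto simp: mem_Times_iff\<close>)

text \<open>Only the groups are constrained. What span composition has to know about the sets and
  actions of the three objects is contained in \<open>gset_over\<close> for the spans.\<close>

locale three_groups =
  fixes A :: "('g, 'x) gset" and B :: "('h, 'y) gset" and C :: "('k, 'z) gset"
  assumes group_A: "group (grp A)" and group_B: "group (grp B)" and group_C: "group (grp C)"
begin

sublocale A: group "grp A" by (rule group_A)
sublocale B: group "grp B" by (rule group_B)
sublocale C: group "grp C" by (rule group_C)

end

locale composable_spans = three_groups A B C
  for A :: "('g, 'x) gset" and B :: "('h, 'y) gset" and C :: "('k, 'z) gset" +
  fixes V :: "('k \<times> 'h, 'v, 'z \<times> 'y) slice" and U :: "('h \<times> 'g, 'u, 'y \<times> 'x) slice"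
  assumes V: "gset_over (ext_prod C B) V" and U: "gset_over (ext_prod B A) U"
begin

lemmas actV = gset_over_ext_prodD[OF V]
lemmas actU = gset_over_ext_prodD[OF U]

abbreviation orb :: "'v \<Rightarrow> 'u \<Rightarrow> ('v \<times> 'u) set" where "orb \<equiv> span_orbit A B C V U"

abbreviation pair :: "'v \<Rightarrow> 'u \<Rightarrow> bool" where
  "pair v u \<equiv> v \<in> tot V \<and> u \<in> tot U \<and> snd (proj V v) = fst (proj U u)"

abbreviation comp :: "('k \<times> 'g, ('v \<times> 'u) set, 'z \<times> 'x) slice" where
  "comp \<equiv> span_comp A B C V U"

lemma orb_eq:
  "orb v u = (\<lambda>h. (act V (\<one>\<^bsub>grp C\<^esub>, h) v, act U (h, \<one>\<^bsub>grp A\<^esub>) u)) ` carrier (grp B)"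
proof -
  have "m_inv (grp B) ` carrier (grp B) = carrier (grp B)"
    by (auto intro: rev_image_eqI[OF B.inv_closed])
  then have "(\<lambda>h. (act V (\<one>\<^bsub>grp C\<^esub>, h) v, act U (h, \<one>\<^bsub>grp A\<^esub>) u)) ` carrier (grp B) =
     (\<lambda>h. (act V (\<one>\<^bsub>grp C\<^esub>, h) v, act U (h, \<one>\<^bsub>grp A\<^esub>) u)) ` m_inv (grp B) ` carrier (grp B)"
    by simp
  then show ?thesis unfolding span_orbit_def by (auto simp: image_image)
qed

lemma pair_act:
  assumes "pair v u" "k \<in> carrier (grp C)" "h \<in> carrier (grp B)" "g \<in> carrier (grp A)"
  shows "pair (act V (k, h) v) (act U (h, g) u)"
  using assms by (simp add: actV(3,9) actU(3,8))

lemma orb_refl: "v \<in> tot V \<Longrightarrow> u \<in> tot U \<Longrightarrow> (v, u) \<in> orb v u"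
  unfolding orb_eq by (rule image_eqI[of _ _ "\<one>\<^bsub>grp B\<^esub>"]) (simp_all add: actV(4) actU(4))

lemma orb_act:
  assumes "v \<in> tot V" "u \<in> tot U" and h: "h \<in> carrier (grp B)"
  shows "orb (act V (\<one>\<^bsub>grp C\<^esub>, h) v) (act U (h, \<one>\<^bsub>grp A\<^esub>) u) = orb v u"
proof -
  have "(\<lambda>h'. h' \<otimes>\<^bsub>grp B\<^esub> h) ` carrier (grp B) = carrier (grp B)"
  proof (intro equalityI subsetI)
    fix y assume "y \<in> carrier (grp B)"
    then show "y \<in> (\<lambda>h'. h' \<otimes>\<^bsub>grp B\<^esub> h) ` carrier (grp B)"
      using h by (intro image_eqI[of _ _ "y \<otimes>\<^bsub>grp B\<^esub> inv\<^bsub>grp B\<^esub> h"]) (simp_all add: B.m_assoc)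
  qed (use h in auto)
  then have "orb v u = (\<lambda>h. (act V (\<one>\<^bsub>grp C\<^esub>, h) v, act U (h, \<one>\<^bsub>grp A\<^esub>) u)) `
      (\<lambda>h'. h' \<otimes>\<^bsub>grp B\<^esub> h) ` carrier (grp B)" by (simp add: orb_eq)
  also have "\<dots> = orb (act V (\<one>\<^bsub>grp C\<^esub>, h) v) (act U (h, \<one>\<^bsub>grp A\<^esub>) u)"
    unfolding orb_eq image_image using assms by (intro image_cong) (simp_all add: actV(5) actU(5))
  finally show ?thesis by simp
qed

lemma orb_eqD:
  assumes "v \<in> tot V" "u \<in> tot U" "orb v u = orb v' u'" "v' \<in> tot V" "u' \<in> tot U"
  obtains h where "h \<in> carrier (grp B)" "v' = act V (\<one>\<^bsub>grp C\<^esub>, h) v" "u' = act U (h, \<one>\<^bsub>grp A\<^esub>) u"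
proof -
  have "(v', u') \<in> orb v u" using orb_refl[OF assms(4,5)] assms(3) by simp
  then show thesis using that by (auto simp: orb_eq[of v u])
qed

lemma the_elem_orb:
  assumes "v \<in> tot V" "u \<in> tot U"
    and "\<And>h. h \<in> carrier (grp B) \<Longrightarrow>
      f (act V (\<one>\<^bsub>grp C\<^esub>, h) v, act U (h, \<one>\<^bsub>grp A\<^esub>) u) = f (v, u)"
  shows "the_elem (f ` orb v u) = f (v, u)"
proof -
  have "f ` orb v u = {f (v, u)}"
    using assms(3) orb_refl[OF assms(1,2)] unfolding orb_eq by (auto simp: image_image)
  then show ?thesis by simp
qed

lemma tot_comp: "tot comp = {orb v u |v u. pair v u}"
  by (simp add: span_comp_def Let_def)

text \<open>The outer groups commute with the middle one, as
  \<open>(k, 1) (1, h) = (k, h) = (1, h) (k, 1)\<close>; hence the image of an orbit is again an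
  orbit.\<close>

lemma act_comp:
  assumes "pair v u" "k \<in> carrier (grp C)" "g \<in> carrier (grp A)"
  shows "act comp (k, g) (orb v u) = orb (act V (k, \<one>\<^bsub>grp B\<^esub>) v) (act U (\<one>\<^bsub>grp B\<^esub>, g) u)"
proof -
  have "orb v u \<in> tot comp" using assms(1) tot_comp by blast
  then have "act comp (k, g) (orb v u) =
      map_prod (act V (k, \<one>\<^bsub>grp B\<^esub>)) (act U (\<one>\<^bsub>grp B\<^esub>, g)) ` orb v u"
    by (simp add: span_comp_def Let_def)
  also have "\<dots> = orb (act V (k, \<one>\<^bsub>grp B\<^esub>) v) (act U (\<one>\<^bsub>grp B\<^esub>, g) u)"
    unfolding orb_eq image_image using assms
    by (intro image_cong) (simp_all add: actV(5) actU(5))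
  finally show ?thesis .
qed

text \<open>\<open>gact C\<close> and \<open>gact A\<close> are not assumed to be actions here. That
  their units fix the points in question is read off from equivariance of \<open>proj\<close> at the
  unit of the product group.\<close>

lemma proj_act_middle:
  assumes "h \<in> carrier (grp B)"
  shows "v \<in> tot V \<Longrightarrow> fst (proj V (act V (\<one>\<^bsub>grp C\<^esub>, h) v)) = fst (proj V v)"
    and "u \<in> tot U \<Longrightarrow> snd (proj U (act U (h, \<one>\<^bsub>grp A\<^esub>) u)) = snd (proj U u)"
  using assms actV(8)[of "\<one>\<^bsub>grp C\<^esub>" "\<one>\<^bsub>grp B\<^esub>" v] actU(9)[of "\<one>\<^bsub>grp B\<^esub>" "\<one>\<^bsub>grp A\<^esub>" u]
  by (simp_all add: actV(4,8) actU(4,9))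

lemma proj_comp:
  assumes "pair v u"
  shows "proj comp (orb v u) = (fst (proj V v), snd (proj U u))"
  using assms
  by (simp add: span_comp_def Let_def the_elem_orb[where f = "\<lambda>(v, u). (fst (proj V v), snd (proj U u))"]
      proj_act_middle)

lemma gset_over_comp: "gset_over (ext_prod C A) comp"
proof (rule gset_over_ext_prodI[OF group_C group_A])
  have "tot comp = (\<lambda>(v, u). orb v u) ` {(v, u). pair v u}" unfolding tot_comp by auto
  moreover have "finite {(v, u). pair v u}"
    by (rule finite_subset[of _ "tot V \<times> tot U"]) (auto simp: actV(1) actU(1))
  ultimately show "finite (tot comp)" by simp
next
  fix k g assume "k \<in> carrier (grp C)" "g \<in> carrier (grp A)"
  show "act comp (k, g) \<in> extensional (tot comp)" by (simp add: span_comp_def Let_def)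
next
  fix k g w assume kg: "k \<in> carrier (grp C)" "g \<in> carrier (grp A)" and "w \<in> tot comp"
  then obtain v u where w: "w = orb v u" "pair v u" unfolding tot_comp by blast
  note p = pair_act[OF w(2) kg(1) B.one_closed kg(2)]
  show "act comp (k, g) w \<in> tot comp"
    unfolding w(1) act_comp[OF w(2) kg] tot_comp using p by blast
  show "fst (proj comp (act comp (k, g) w)) = gact C k (fst (proj comp w))"
    "snd (proj comp (act comp (k, g) w)) = gact A g (snd (proj comp w))"
    unfolding w(1) act_comp[OF w(2) kg] proj_comp[OF p] proj_comp[OF w(2)]
    using w(2) kg by (simp_all add: actV(8) actU(9))
next
  fix w assume "w \<in> tot comp"
  then obtain v u where w: "w = orb v u" "pair v u" unfolding tot_comp by blast
  show "act comp (\<one>\<^bsub>grp C\<^esub>, \<one>\<^bsub>grp A\<^esub>) w = w"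
    using w(2) by (simp add: w(1) act_comp actV(4) actU(4))
  show "fst (proj comp w) \<in> pts C" "snd (proj comp w) \<in> pts A"
    using w(2) by (simp_all add: w(1) proj_comp actV(6) actU(7))
next
  fix k g k' g' w
  assume kg: "k \<in> carrier (grp C)" "g \<in> carrier (grp A)" "k' \<in> carrier (grp C)" "g' \<in> carrier (grp A)"
    and "w \<in> tot comp"
  then obtain v u where w: "w = orb v u" "pair v u" unfolding tot_comp by blast
  note p = pair_act[OF w(2) kg(3) B.one_closed kg(4)]
  show "act comp (k \<otimes>\<^bsub>grp C\<^esub> k', g \<otimes>\<^bsub>grp A\<^esub> g') w = act comp (k, g) (act comp (k', g') w)"
    unfolding w(1) act_comp[OF w(2) kg(3,4)] act_comp[OF p kg(1,2)]
    using act_comp[OF w(2), of "k \<otimes>\<^bsub>grp C\<^esub> k'" "g \<otimes>\<^bsub>grp A\<^esub> g'"] w(2) kg by (simp add: actV(5) actU(5))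
qed

text \<open>A map out of the set of orbits is a map on matching pairs that is invariant under the
  middle group, and it is injective if pairs with equal values differ by an element of that group.
  Every explicit isomorphism out of a composite below is built in this way.\<close>

lemma over_iso_compI:
  assumes tot: "\<And>v u. pair v u \<Longrightarrow> f v u \<in> tot T"
    and surj: "\<And>t. t \<in> tot T \<Longrightarrow> \<exists>v u. pair v u \<and> f v u = t"
    and inj: "\<And>v u v' u'. pair v u \<Longrightarrow> pair v' u' \<Longrightarrow> f v u = f v' u' \<Longrightarrow>
      \<exists>h\<in>carrier (grp B). v' = act V (\<one>\<^bsub>grp C\<^esub>, h) v \<and> u' = act U (h, \<one>\<^bsub>grp A\<^esub>) u"
    and inv: "\<And>v u h. pair v u \<Longrightarrow> h \<in> carrier (grp B) \<Longrightarrow>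
      f (act V (\<one>\<^bsub>grp C\<^esub>, h) v) (act U (h, \<one>\<^bsub>grp A\<^esub>) u) = f v u"
    and equiv: "\<And>v u k g. pair v u \<Longrightarrow> k \<in> carrier (grp C) \<Longrightarrow> g \<in> carrier (grp A) \<Longrightarrow>
      act T (k, g) (f v u) = f (act V (k, \<one>\<^bsub>grp B\<^esub>) v) (act U (\<one>\<^bsub>grp B\<^esub>, g) u)"
    and proj: "\<And>v u. pair v u \<Longrightarrow> proj T (f v u) = (fst (proj V v), snd (proj U u))"
  shows "over_iso (ext_prod C A) comp T"
proof -
  \<comment> \<open>By invariance \<open>f\<close> takes a single value on the orbit
    \<open>w\<close>, and \<open>the_elem\<close> extracts it.\<close>
  define F where "F w = the_elem ((\<lambda>(v, u). f v u) ` w)" for w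
  have F: "F (orb v u) = f v u" if "pair v u" for v u
    using that the_elem_orb[of v u "\<lambda>(v, u). f v u"] inv by (simp add: F_def)
  have "inj_on F (tot comp)"
  proof (rule inj_onI)
    fix w w' assume "w \<in> tot comp" "w' \<in> tot comp" and eq: "F w = F w'"
    then obtain v u v' u' where w: "w = orb v u" "pair v u" and w': "w' = orb v' u'" "pair v' u'"
      unfolding tot_comp by blast
    then have "f v u = f v' u'" using eq by (simp add: F)
    from inj[OF w(2) w'(2) this] obtain h where "h \<in> carrier (grp B)"
      "v' = act V (\<one>\<^bsub>grp C\<^esub>, h) v" "u' = act U (h, \<one>\<^bsub>grp A\<^esub>) u" by blast
    then show "w = w'" using w w'(1) orb_act by simp
  qed
  moreover have "F ` tot comp = tot T"
  proof (intro equalityI subsetI)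
    fix t assume "t \<in> F ` tot comp"
    then show "t \<in> tot T" unfolding tot_comp using F tot by auto
  next
    fix t assume "t \<in> tot T"
    then obtain v u where vu: "pair v u" and t: "f v u = t" using surj by blast
    then have "orb v u \<in> tot comp" unfolding tot_comp by blast
    then show "t \<in> F ` tot comp" by (rule rev_image_eqI) (simp add: F[OF vu] t)
  qed
  moreover have "F (act comp p w) = act T p (F w)" "proj T (F w) = proj comp w"
    if pC: "p \<in> carrier (grp (ext_prod C A))" and wT: "w \<in> tot comp" for p w
  proof -
    obtain k g where p: "p = (k, g)" and kg: "k \<in> carrier (grp C)" "g \<in> carrier (grp A)"
      using pC by (cases p) (auto simp: ext_prod_def)
    obtain v u where w: "w = orb v u" "pair v u" using wT unfolding tot_comp by blast
    note q = pair_act[OF w(2) kg(1) B.one_closed kg(2)]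
    show "F (act comp p w) = act T p (F w)"
      unfolding w(1) p act_comp[OF w(2) kg] F[OF w(2)] F[OF q] by (simp add: equiv w(2) kg)
    show "proj T (F w) = proj comp w"
      unfolding w(1) F[OF w(2)] proj_comp[OF w(2)] by (rule proj[OF w(2)])
  qed
  \<comment> \<open>Compatibility with \<open>proj\<close> was proved jointly with equivariance,
    under a group element \<open>p\<close>; the unit supplies such a \<open>p\<close>.\<close>
  moreover have "\<one>\<^bsub>grp (ext_prod C A)\<^esub> \<in> carrier (grp (ext_prod C A))" by (simp add: ext_prod_def)
  ultimately show ?thesis unfolding over_iso_def bij_betw_def by (intro exI[of _ F]) blast
qed

end

lemma over_iso_ext_prodE:
  assumes "over_iso (ext_prod B A) S T"
  obtains f where "bij_betw f (tot S) (tot T)"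
    "\<And>h g u. h \<in> carrier (grp B) \<Longrightarrow> g \<in> carrier (grp A) \<Longrightarrow> u \<in> tot S \<Longrightarrow>
       f (act S (h, g) u) = act T (h, g) (f u)"
    "\<And>u. u \<in> tot S \<Longrightarrow> proj T (f u) = proj S u"
  using assms unfolding over_iso_def by (auto simp: ext_prod_def)

section \<open>Functoriality and distributivity of span composition\<close>

context three_groups
begin

lemma composable_spansI:
  assumes "gset_over (ext_prod C B) V" and "gset_over (ext_prod B A) U"
  shows "composable_spans A B C V U"
  using assms three_groups_axioms by (simp add: composable_spans_def composable_spans_axioms_def)

lemma over_iso_span_comp:
  assumes V: "gset_over (ext_prod C B) V" "gset_over (ext_prod C B) V'"
    and U: "gset_over (ext_prod B A) U" "gset_over (ext_prod B A) U'"
    and isoV: "over_iso (ext_prod C B) V V'" and isoU: "over_iso (ext_prod B A) U U'"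
  shows "over_iso (ext_prod C A) (span_comp A B C V U) (span_comp A B C V' U')"
proof -
  interpret S: composable_spans A B C V U by (rule composable_spansI[OF V(1) U(1)])
  interpret T: composable_spans A B C V' U' by (rule composable_spansI[OF V(2) U(2)])
  obtain i where i: "bij_betw i (tot V) (tot V')"
    "\<And>k h v. k \<in> carrier (grp C) \<Longrightarrow> h \<in> carrier (grp B) \<Longrightarrow> v \<in> tot V \<Longrightarrow>
       i (act V (k, h) v) = act V' (k, h) (i v)"
    "\<And>v. v \<in> tot V \<Longrightarrow> proj V' (i v) = proj V v"
    by (rule over_iso_ext_prodE[OF isoV]) blast
  obtain j where j: "bij_betw j (tot U) (tot U')"
    "\<And>h g u. h \<in> carrier (grp B) \<Longrightarrow> g \<in> carrier (grp A) \<Longrightarrow> u \<in> tot U \<Longrightarrow>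
       j (act U (h, g) u) = act U' (h, g) (j u)"
    "\<And>u. u \<in> tot U \<Longrightarrow> proj U' (j u) = proj U u"
    by (rule over_iso_ext_prodE[OF isoU]) blast
  have pair: "T.pair (i v) (j u)" if "S.pair v u" for v u
    using that i(3) j(3) bij_betwE[OF i(1)] bij_betwE[OF j(1)] by simp
  show ?thesis
  proof (rule S.over_iso_compI[where f = "\<lambda>v u. T.orb (i v) (j u)"])
    fix v u assume p: "S.pair v u"
    note q = pair[OF p]
    show "T.orb (i v) (j u) \<in> tot T.comp" unfolding T.tot_comp using q by blast
    show "proj T.comp (T.orb (i v) (j u)) = (fst (proj V v), snd (proj U u))"
      using p by (simp add: T.proj_comp[OF q] i(3) j(3))
    show "T.orb (i (act V (\<one>\<^bsub>grp C\<^esub>, h) v)) (j (act U (h, \<one>\<^bsub>grp A\<^esub>) u)) = T.orb (i v) (j u)"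
      if "h \<in> carrier (grp B)" for h
      using p q that by (simp add: i(2) j(2) T.orb_act)
    show "act T.comp (k, g) (T.orb (i v) (j u)) =
        T.orb (i (act V (k, \<one>\<^bsub>grp B\<^esub>) v)) (j (act U (\<one>\<^bsub>grp B\<^esub>, g) u))"
      if "k \<in> carrier (grp C)" "g \<in> carrier (grp A)" for k g
      using p that by (simp add: T.act_comp[OF q] i(2) j(2))
    fix v' u' assume p': "S.pair v' u'" and eq: "T.orb (i v) (j u) = T.orb (i v') (j u')"
    note q' = pair[OF p']
    obtain h where h: "h \<in> carrier (grp B)" "i v' = act V' (\<one>\<^bsub>grp C\<^esub>, h) (i v)"
      "j u' = act U' (h, \<one>\<^bsub>grp A\<^esub>) (j u)"
      using T.orb_eqD[OF _ _ eq] q q' by blast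
    \<comment> \<open>The element \<open>h\<close> found for the images also works for the
      originals, because \<open>i\<close> and \<open>j\<close> are equivariant and
      injective.\<close>
    have "i v' = i (act V (\<one>\<^bsub>grp C\<^esub>, h) v)" "j u' = j (act U (h, \<one>\<^bsub>grp A\<^esub>) u)"
      using h p by (simp_all add: i(2) j(2))
    then have "v' = act V (\<one>\<^bsub>grp C\<^esub>, h) v" "u' = act U (h, \<one>\<^bsub>grp A\<^esub>) u"
      using p p' h(1) by (auto intro!: inj_onD[OF bij_betw_imp_inj_on[OF i(1)]]
          inj_onD[OF bij_betw_imp_inj_on[OF j(1)]] S.actV(3) S.actU(3))
    then show "\<exists>h\<in>carrier (grp B). v' = act V (\<one>\<^bsub>grp C\<^esub>, h) v \<and> u' = act U (h, \<one>\<^bsub>grp A\<^esub>) u"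
      using h(1) by blast
  next
    fix t assume "t \<in> tot T.comp"
    then obtain v' u' where t: "t = T.orb v' u'" and q: "T.pair v' u'" unfolding T.tot_comp by blast
    obtain v u where vu: "v \<in> tot V" "v' = i v" "u \<in> tot U" "u' = j u"
      using q bij_betw_imp_surj_on[OF i(1)] bij_betw_imp_surj_on[OF j(1)] by blast
    then have "S.pair v u" using q by (simp add: i(3) j(3))
    then show "\<exists>v u. S.pair v u \<and> T.orb (i v) (j u) = t" using t vu by blast
  qed
qed

text \<open>The middle group preserves each summand of \<open>over_sum V V'\<close>, so no orbit of
  matching pairs meets both summands.\<close>

lemma over_iso_span_comp_sum_left:
  assumes V: "gset_over (ext_prod C B) V" "gset_over (ext_prod C B) V'"
    and U: "gset_over (ext_prod B A) U"
  shows "over_iso (ext_prod C A) (span_comp A B C (over_sum V V') U)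
    (over_sum (span_comp A B C V U) (span_comp A B C V' U))"
proof -
  interpret S: composable_spans A B C V U by (rule composable_spansI[OF V(1) U])
  interpret T: composable_spans A B C V' U by (rule composable_spansI[OF V(2) U])
  interpret ST: composable_spans A B C "over_sum V V'" U
    by (rule composable_spansI[OF gset_over_over_sum[OF V] U])
  define f where "f v u = map_sum (\<lambda>v. S.orb v u) (\<lambda>v. T.orb v u) v" for v u
  have cases: thesis
    if "ST.pair v u" and "\<And>w. v = Inl w \<Longrightarrow> S.pair w u \<Longrightarrow> thesis"
      and "\<And>w. v = Inr w \<Longrightarrow> T.pair w u \<Longrightarrow> thesis" for v u thesis
    using that by (cases v) (auto simp: over_sum_def)
  have L: "S.orb v u \<in> tot S.comp" if "S.pair v u" for v u
    unfolding S.tot_comp using that by blast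
  have R: "T.orb v u \<in> tot T.comp" if "T.pair v u" for v u
    unfolding T.tot_comp using that by blast
  show ?thesis
  proof (rule ST.over_iso_compI[where f = f])
    fix v u assume p: "ST.pair v u"
    show "f v u \<in> tot (over_sum S.comp T.comp)"
      by (rule cases[OF p]) (simp_all add: f_def over_sum_def L R InlI InrI)
    show "proj (over_sum S.comp T.comp) (f v u) = (fst (proj (over_sum V V') v), snd (proj U u))"
      by (rule cases[OF p]) (simp_all add: f_def over_sum_def S.proj_comp T.proj_comp)
    show "f (act (over_sum V V') (\<one>\<^bsub>grp C\<^esub>, h) v) (act U (h, \<one>\<^bsub>grp A\<^esub>) u) = f v u"
      if "h \<in> carrier (grp B)" for h
      by (rule cases[OF p]) (simp_all add: f_def over_sum_def S.orb_act T.orb_act InlI InrI that)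
    show "act (over_sum S.comp T.comp) (k, g) (f v u) =
        f (act (over_sum V V') (k, \<one>\<^bsub>grp B\<^esub>) v) (act U (\<one>\<^bsub>grp B\<^esub>, g) u)"
      if "k \<in> carrier (grp C)" "g \<in> carrier (grp A)" for k g
      by (rule cases[OF p])
        (simp_all add: f_def over_sum_def S.act_comp T.act_comp InlI InrI L R that)
    fix v' u' assume p': "ST.pair v' u'" and eq: "f v u = f v' u'"
    show "\<exists>h\<in>carrier (grp B). v' = act (over_sum V V') (\<one>\<^bsub>grp C\<^esub>, h) v \<and> u' = act U (h, \<one>\<^bsub>grp A\<^esub>) u"
    proof (rule cases[OF p])
      fix w assume w: "v = Inl w" "S.pair w u"
      obtain w' where w': "v' = Inl w'" "S.pair w' u'"
        by (rule cases[OF p']) (use eq w(1) in \<open>auto simp: f_def\<close>)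
      then have "S.orb w u = S.orb w' u'" using eq w by (simp add: f_def)
      then obtain h where "h \<in> carrier (grp B)" "w' = act V (\<one>\<^bsub>grp C\<^esub>, h) w"
        "u' = act U (h, \<one>\<^bsub>grp A\<^esub>) u" using S.orb_eqD w(2) w'(2) by blast
      then show ?thesis using w w' by (intro bexI[of _ h]) (simp_all add: over_sum_def InlI)
    next
      fix w assume w: "v = Inr w" "T.pair w u"
      obtain w' where w': "v' = Inr w'" "T.pair w' u'"
        by (rule cases[OF p']) (use eq w(1) in \<open>auto simp: f_def\<close>)
      then have "T.orb w u = T.orb w' u'" using eq w by (simp add: f_def)
      then obtain h where "h \<in> carrier (grp B)" "w' = act V' (\<one>\<^bsub>grp C\<^esub>, h) w"
        "u' = act U (h, \<one>\<^bsub>grp A\<^esub>) u" using T.orb_eqD w(2) w'(2) by blast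
      then show ?thesis using w w' by (intro bexI[of _ h]) (simp_all add: over_sum_def InrI)
    qed
  next
    fix t assume "t \<in> tot (over_sum S.comp T.comp)"
    then consider v u where "t = Inl (S.orb v u)" "S.pair v u"
      | v u where "t = Inr (T.orb v u)" "T.pair v u"
      by (auto simp: over_sum_def S.tot_comp T.tot_comp)
    then show "\<exists>v u. ST.pair v u \<and> f v u = t"
    proof cases
      case (1 v u)
      then show ?thesis by (intro exI[of _ "Inl v"] exI[of _ u]) (simp add: f_def over_sum_def InlI)
    next
      case (2 v u)
      then show ?thesis by (intro exI[of _ "Inr v"] exI[of _ u]) (simp add: f_def over_sum_def InrI)
    qed
  qed
qed

lemma over_iso_span_comp_sum_right:
  assumes V: "gset_over (ext_prod C B) V"
    and U: "gset_over (ext_prod B A) U" "gset_over (ext_prod B A) U'"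
  shows "over_iso (ext_prod C A) (span_comp A B C V (over_sum U U'))
    (over_sum (span_comp A B C V U) (span_comp A B C V U'))"
proof -
  interpret S: composable_spans A B C V U by (rule composable_spansI[OF V U(1)])
  interpret T: composable_spans A B C V U' by (rule composable_spansI[OF V U(2)])
  interpret ST: composable_spans A B C V "over_sum U U'"
    by (rule composable_spansI[OF V gset_over_over_sum[OF U]])
  define f where "f v u = map_sum (S.orb v) (T.orb v) u" for v u
  have cases: thesis
    if "ST.pair v u" and "\<And>w. u = Inl w \<Longrightarrow> S.pair v w \<Longrightarrow> thesis"
      and "\<And>w. u = Inr w \<Longrightarrow> T.pair v w \<Longrightarrow> thesis" for v u thesis
    using that by (cases u) (auto simp: over_sum_def)
  have L: "S.orb v u \<in> tot S.comp" if "S.pair v u" for v u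
    unfolding S.tot_comp using that by blast
  have R: "T.orb v u \<in> tot T.comp" if "T.pair v u" for v u
    unfolding T.tot_comp using that by blast
  show ?thesis
  proof (rule ST.over_iso_compI[where f = f])
    fix v u assume p: "ST.pair v u"
    show "f v u \<in> tot (over_sum S.comp T.comp)"
      by (rule cases[OF p]) (simp_all add: f_def over_sum_def L R InlI InrI)
    show "proj (over_sum S.comp T.comp) (f v u) = (fst (proj V v), snd (proj (over_sum U U') u))"
      by (rule cases[OF p]) (simp_all add: f_def over_sum_def S.proj_comp T.proj_comp)
    show "f (act V (\<one>\<^bsub>grp C\<^esub>, h) v) (act (over_sum U U') (h, \<one>\<^bsub>grp A\<^esub>) u) = f v u"
      if "h \<in> carrier (grp B)" for h
      by (rule cases[OF p]) (simp_all add: f_def over_sum_def S.orb_act T.orb_act InlI InrI that)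
    show "act (over_sum S.comp T.comp) (k, g) (f v u) =
        f (act V (k, \<one>\<^bsub>grp B\<^esub>) v) (act (over_sum U U') (\<one>\<^bsub>grp B\<^esub>, g) u)"
      if "k \<in> carrier (grp C)" "g \<in> carrier (grp A)" for k g
      by (rule cases[OF p])
        (simp_all add: f_def over_sum_def S.act_comp T.act_comp InlI InrI L R that)
    fix v' u' assume p': "ST.pair v' u'" and eq: "f v u = f v' u'"
    show "\<exists>h\<in>carrier (grp B). v' = act V (\<one>\<^bsub>grp C\<^esub>, h) v \<and> u' = act (over_sum U U') (h, \<one>\<^bsub>grp A\<^esub>) u"
    proof (rule cases[OF p])
      fix w assume w: "u = Inl w" "S.pair v w"
      obtain w' where w': "u' = Inl w'" "S.pair v' w'"
        by (rule cases[OF p']) (use eq w(1) in \<open>auto simp: f_def\<close>)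
      then have "S.orb v w = S.orb v' w'" using eq w by (simp add: f_def)
      then obtain h where "h \<in> carrier (grp B)" "v' = act V (\<one>\<^bsub>grp C\<^esub>, h) v"
        "w' = act U (h, \<one>\<^bsub>grp A\<^esub>) w" using S.orb_eqD w(2) w'(2) by blast
      then show ?thesis using w w' by (intro bexI[of _ h]) (simp_all add: over_sum_def InlI)
    next
      fix w assume w: "u = Inr w" "T.pair v w"
      obtain w' where w': "u' = Inr w'" "T.pair v' w'"
        by (rule cases[OF p']) (use eq w(1) in \<open>auto simp: f_def\<close>)
      then have "T.orb v w = T.orb v' w'" using eq w by (simp add: f_def)
      then obtain h where "h \<in> carrier (grp B)" "v' = act V (\<one>\<^bsub>grp C\<^esub>, h) v"
        "w' = act U' (h, \<one>\<^bsub>grp A\<^esub>) w" using T.orb_eqD w(2) w'(2) by blast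
      then show ?thesis using w w' by (intro bexI[of _ h]) (simp_all add: over_sum_def InrI)
    qed
  next
    fix t assume "t \<in> tot (over_sum S.comp T.comp)"
    then consider v u where "t = Inl (S.orb v u)" "S.pair v u"
      | v u where "t = Inr (T.orb v u)" "T.pair v u"
      by (auto simp: over_sum_def S.tot_comp T.tot_comp)
    then show "\<exists>v u. ST.pair v u \<and> f v u = t"
    proof cases
      case (1 v u)
      then show ?thesis by (intro exI[of _ v] exI[of _ "Inl u"]) (simp add: f_def over_sum_def InlI)
    next
      case (2 v u)
      then show ?thesis by (intro exI[of _ v] exI[of _ "Inr u"]) (simp add: f_def over_sum_def InrI)
    qed
  qed
qed

lemma gset_over_span_comp:
  assumes "gset_over (ext_prod C B) V" and "gset_over (ext_prod B A) U"
  shows "gset_over (ext_prod C A) (span_comp A B C V U)"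
proof -
  interpret composable_spans A B C V U by (rule composable_spansI[OF assms])
  show ?thesis by (rule gset_over_comp)
qed

end

section \<open>Composition on Burnside groups and tensor products\<close>

lemma normal_free_Abelian_group:
  assumes "subgroup N (free_Abelian_group S)" shows "N \<lhd> free_Abelian_group S"
  using abelian_free_Abelian_group assms comm_group.subgroup_imp_normal by blast

lemma mult_Mod_free_Abelian_group:
  assumes "subgroup N (free_Abelian_group S)"
    and "Poly_Mapping.keys x \<subseteq> S" "Poly_Mapping.keys y \<subseteq> S"
  shows "(N #>\<^bsub>free_Abelian_group S\<^esub> x) \<otimes>\<^bsub>free_Abelian_group S Mod N\<^esub> (N #>\<^bsub>free_Abelian_group S\<^esub> y)
    = N #>\<^bsub>free_Abelian_group S\<^esub> (x + y)"
  using normal.rcos_sum[OF normal_free_Abelian_group[OF assms(1)]] assms(2,3) by simp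

lemma carrier_burnside: "carrier (burnside Z) =
  {burnside_rel Z #>\<^bsub>burnside_free Z\<^esub> c |c. Poly_Mapping.keys c \<subseteq> {S. gset_over Z S}}"
  unfolding burnside_def carrier_FactGroup by auto

lemma mult_burnside:
  assumes "Poly_Mapping.keys c \<subseteq> {S. gset_over Z S}" "Poly_Mapping.keys d \<subseteq> {S. gset_over Z S}"
  shows "(burnside_rel Z #>\<^bsub>burnside_free Z\<^esub> c) \<otimes>\<^bsub>burnside Z\<^esub> (burnside_rel Z #>\<^bsub>burnside_free Z\<^esub> d)
    = burnside_rel Z #>\<^bsub>burnside_free Z\<^esub> (c + d)"
  unfolding burnside_def by (rule mult_Mod_free_Abelian_group[OF subgroup_burnside_rel assms])

lemma burnside_mult_closed:
  assumes "a \<in> carrier (burnside Z)" "b \<in> carrier (burnside Z)"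
  shows "a \<otimes>\<^bsub>burnside Z\<^esub> b \<in> carrier (burnside Z)"
proof -
  have "group (burnside Z)" unfolding burnside_def
    by (rule normal.factorgroup_is_group[OF normal_free_Abelian_group[OF subgroup_burnside_rel]])
  then show ?thesis using assms by (simp add: group.is_monoid monoid.m_closed)
qed

lemma over_class_closed: "gset_over Z S \<Longrightarrow> over_class Z S \<in> carrier (burnside Z)"
  unfolding over_class_def carrier_burnside using gset_over_nat_copy[of Z S] by force

context three_groups
begin

definition comp_frag :: "('k \<times> 'h, nat, 'z \<times> 'y) slice \<Rightarrow> ('h \<times> 'g, nat, 'y \<times> 'x) slice \<Rightarrow>
    (('k \<times> 'g, nat, 'z \<times> 'x) slice \<Rightarrow>\<^sub>0 int)" where
  "comp_frag V U = frag_of (nat_copy (span_comp A B C V U))"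

lemma keys_comp_frag:
  assumes "Poly_Mapping.keys d \<subseteq> {V. gset_over (ext_prod C B) V}"
    and "Poly_Mapping.keys c \<subseteq> {U. gset_over (ext_prod B A) U}"
  shows "Poly_Mapping.keys (frag_extend2 comp_frag d c) \<subseteq> {W. gset_over (ext_prod C A) W}"
  using assms
  by (rule keys_frag_extend2[rotated]) (simp add: comp_frag_def gset_over_span_comp gset_over_nat_copy)

text \<open>An isomorphism relator goes to an isomorphism relator by functoriality. A disjoint-union
  relator goes to one of the same kind by distributivity, once the copy of the sum has been replaced
  by the sum itself.\<close>

lemma comp_frag_gens_left:
  assumes r: "r \<in> burnside_gens (ext_prod C B)" and U: "gset_over (ext_prod B A) U"
  shows "frag_extend (\<lambda>V. comp_frag V U) r \<in> burnside_rel (ext_prod C A)"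
  using r
proof
  assume "r \<in> {frag_of S - frag_of T |S T. gset_over (ext_prod C B) S \<and>
    gset_over (ext_prod C B) T \<and> over_iso (ext_prod C B) S T}"
  then obtain S T where ST: "gset_over (ext_prod C B) S" "gset_over (ext_prod C B) T"
    "over_iso (ext_prod C B) S T" and r: "r = frag_of S - frag_of T" by blast
  show ?thesis
    unfolding r frag_extend_diff frag_extend_of comp_frag_def
    by (intro burnside_rel_iso gset_over_span_comp over_iso_span_comp ST U over_iso_refl)
next
  assume "r \<in> {frag_of (nat_copy (over_sum S T)) - frag_of S - frag_of T |S T.
    gset_over (ext_prod C B) S \<and> gset_over (ext_prod C B) T}"
  then obtain S T where ST: "gset_over (ext_prod C B) S" "gset_over (ext_prod C B) T"
    and r: "r = frag_of (nat_copy (over_sum S T)) - frag_of S - frag_of T" by blast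
  note sum = gset_over_over_sum[OF ST]
  note nc = gset_over_nat_copy[OF sum]
  have "over_iso (ext_prod C B) (nat_copy (over_sum S T)) (over_sum S T)"
    by (rule over_iso_sym[OF sum over_iso_nat_copy[OF gset_overD(2)[OF sum]]])
  then have "over_iso (ext_prod C A) (span_comp A B C (nat_copy (over_sum S T)) U)
      (over_sum (span_comp A B C S U) (span_comp A B C T U))"
    by (rule over_iso_trans[OF over_iso_span_comp[OF nc sum U U _ over_iso_refl]
          over_iso_span_comp_sum_left[OF ST U]])
  then show ?thesis
    unfolding r frag_extend_diff frag_extend_of comp_frag_def
    by (intro burnside_rel_sum gset_over_span_comp ST U nc)
qed

lemma comp_frag_gens_right:
  assumes r: "r \<in> burnside_gens (ext_prod B A)" and V: "gset_over (ext_prod C B) V"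
  shows "frag_extend (comp_frag V) r \<in> burnside_rel (ext_prod C A)"
  using r
proof
  assume "r \<in> {frag_of S - frag_of T |S T. gset_over (ext_prod B A) S \<and>
    gset_over (ext_prod B A) T \<and> over_iso (ext_prod B A) S T}"
  then obtain S T where ST: "gset_over (ext_prod B A) S" "gset_over (ext_prod B A) T"
    "over_iso (ext_prod B A) S T" and r: "r = frag_of S - frag_of T" by blast
  show ?thesis
    unfolding r frag_extend_diff frag_extend_of comp_frag_def
    by (intro burnside_rel_iso gset_over_span_comp over_iso_span_comp ST V over_iso_refl)
next
  assume "r \<in> {frag_of (nat_copy (over_sum S T)) - frag_of S - frag_of T |S T.
    gset_over (ext_prod B A) S \<and> gset_over (ext_prod B A) T}"
  then obtain S T where ST: "gset_over (ext_prod B A) S" "gset_over (ext_prod B A) T"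
    and r: "r = frag_of (nat_copy (over_sum S T)) - frag_of S - frag_of T" by blast
  note sum = gset_over_over_sum[OF ST]
  note nc = gset_over_nat_copy[OF sum]
  have "over_iso (ext_prod B A) (nat_copy (over_sum S T)) (over_sum S T)"
    by (rule over_iso_sym[OF sum over_iso_nat_copy[OF gset_overD(2)[OF sum]]])
  then have "over_iso (ext_prod C A) (span_comp A B C V (nat_copy (over_sum S T)))
      (over_sum (span_comp A B C V S) (span_comp A B C V T))"
    by (rule over_iso_trans[OF over_iso_span_comp[OF V V nc sum over_iso_refl]
          over_iso_span_comp_sum_right[OF V ST]])
  then show ?thesis
    unfolding r frag_extend_diff frag_extend_of comp_frag_def
    by (intro burnside_rel_sum gset_over_span_comp ST V nc)
qed

text \<open>This lets composites be computed on any chosen representatives; closure and biadditivity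
  are then inherited from \<open>frag_extend2\<close>.\<close>

lemma burnside_comp_coset:
  assumes "Poly_Mapping.keys d \<subseteq> {V. gset_over (ext_prod C B) V}"
    and "Poly_Mapping.keys c \<subseteq> {U. gset_over (ext_prod B A) U}"
  shows "burnside_comp A B C
      (burnside_rel (ext_prod C B) #>\<^bsub>burnside_free (ext_prod C B)\<^esub> d)
      (burnside_rel (ext_prod B A) #>\<^bsub>burnside_free (ext_prod B A)\<^esub> c)
    = burnside_rel (ext_prod C A) #>\<^bsub>burnside_free (ext_prod C A)\<^esub> frag_extend2 comp_frag d c"
proof -
  have "(\<Union>d'\<in>burnside_rel (ext_prod C B) #>\<^bsub>burnside_free (ext_prod C B)\<^esub> d.
      \<Union>c'\<in>burnside_rel (ext_prod B A) #>\<^bsub>burnside_free (ext_prod B A)\<^esub> c.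
        burnside_rel (ext_prod C A) #>\<^bsub>burnside_free (ext_prod C A)\<^esub> frag_extend2 comp_frag d' c') =
      burnside_rel (ext_prod C A) #>\<^bsub>burnside_free (ext_prod C A)\<^esub> frag_extend2 comp_frag d c"
    unfolding burnside_rel_def[of "ext_prod C B"] burnside_rel_def[of "ext_prod B A"]
  proof (rule frag_extend2_cosets[OF burnside_gens_subset burnside_gens_subset subgroup_burnside_rel _ _ assms])
    fix r and U :: "('h \<times> 'g, nat, 'y \<times> 'x) slice" assume "r \<in> burnside_gens (ext_prod C B)" "U \<in> {U. gset_over (ext_prod B A) U}"
    then show "frag_extend (\<lambda>V. comp_frag V U) r \<in> burnside_rel (ext_prod C A)"
      by (intro comp_frag_gens_left) (assumption, blast)
  next
    fix r and V :: "('k \<times> 'h, nat, 'z \<times> 'y) slice" assume "r \<in> burnside_gens (ext_prod B A)" "V \<in> {V. gset_over (ext_prod C B) V}"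
    then show "frag_extend (comp_frag V) r \<in> burnside_rel (ext_prod C A)"
      by (intro comp_frag_gens_right) (assumption, blast)
  qed
  then show ?thesis
    unfolding burnside_comp_def frag_extend2_def comp_frag_def .
qed

lemma burnside_comp_closed:
  assumes "b \<in> carrier (burnside (ext_prod C B))" "a \<in> carrier (burnside (ext_prod B A))"
  shows "burnside_comp A B C b a \<in> carrier (burnside (ext_prod C A))"
proof -
  obtain d where d: "b = burnside_rel (ext_prod C B) #>\<^bsub>burnside_free (ext_prod C B)\<^esub> d"
    "Poly_Mapping.keys d \<subseteq> {V. gset_over (ext_prod C B) V}"
    using assms(1) unfolding carrier_burnside by blast
  obtain c where c: "a = burnside_rel (ext_prod B A) #>\<^bsub>burnside_free (ext_prod B A)\<^esub> c"
    "Poly_Mapping.keys c \<subseteq> {V. gset_over (ext_prod B A) V}"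
    using assms(2) unfolding carrier_burnside by blast
  show ?thesis
    unfolding d(1) c(1) burnside_comp_coset[OF d(2) c(2)] carrier_burnside
    using keys_comp_frag[OF d(2) c(2)] by blast
qed

lemma burnside_comp_mult_left:
  assumes "b \<in> carrier (burnside (ext_prod C B))" "b' \<in> carrier (burnside (ext_prod C B))"
    and "a \<in> carrier (burnside (ext_prod B A))"
  shows "burnside_comp A B C (b \<otimes>\<^bsub>burnside (ext_prod C B)\<^esub> b') a =
    burnside_comp A B C b a \<otimes>\<^bsub>burnside (ext_prod C A)\<^esub> burnside_comp A B C b' a"
proof -
  obtain d where d: "b = burnside_rel (ext_prod C B) #>\<^bsub>burnside_free (ext_prod C B)\<^esub> d"
    "Poly_Mapping.keys d \<subseteq> {V. gset_over (ext_prod C B) V}"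
    using assms(1) unfolding carrier_burnside by blast
  obtain d' where d': "b' = burnside_rel (ext_prod C B) #>\<^bsub>burnside_free (ext_prod C B)\<^esub> d'"
    "Poly_Mapping.keys d' \<subseteq> {V. gset_over (ext_prod C B) V}"
    using assms(2) unfolding carrier_burnside by blast
  obtain c where c: "a = burnside_rel (ext_prod B A) #>\<^bsub>burnside_free (ext_prod B A)\<^esub> c"
    "Poly_Mapping.keys c \<subseteq> {V. gset_over (ext_prod B A) V}"
    using assms(3) unfolding carrier_burnside by blast
  have "Poly_Mapping.keys (d + d') \<subseteq> {V. gset_over (ext_prod C B) V}"
    using d(2) d'(2) keys_add[of d d'] by blast
  then show ?thesis
    unfolding d(1) d'(1) c(1)
    by (simp add: mult_burnside d(2) d'(2) c(2) burnside_comp_coset keys_comp_frag frag_extend2_add_left)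
qed

lemma burnside_comp_mult_right:
  assumes "b \<in> carrier (burnside (ext_prod C B))"
    and "a \<in> carrier (burnside (ext_prod B A))" "a' \<in> carrier (burnside (ext_prod B A))"
  shows "burnside_comp A B C b (a \<otimes>\<^bsub>burnside (ext_prod B A)\<^esub> a') =
    burnside_comp A B C b a \<otimes>\<^bsub>burnside (ext_prod C A)\<^esub> burnside_comp A B C b a'"
proof -
  obtain d where d: "b = burnside_rel (ext_prod C B) #>\<^bsub>burnside_free (ext_prod C B)\<^esub> d"
    "Poly_Mapping.keys d \<subseteq> {V. gset_over (ext_prod C B) V}"
    using assms(1) unfolding carrier_burnside by blast
  obtain c where c: "a = burnside_rel (ext_prod B A) #>\<^bsub>burnside_free (ext_prod B A)\<^esub> c"
    "Poly_Mapping.keys c \<subseteq> {V. gset_over (ext_prod B A) V}"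
    using assms(2) unfolding carrier_burnside by blast
  obtain c' where c': "a' = burnside_rel (ext_prod B A) #>\<^bsub>burnside_free (ext_prod B A)\<^esub> c'"
    "Poly_Mapping.keys c' \<subseteq> {V. gset_over (ext_prod B A) V}"
    using assms(3) unfolding carrier_burnside by blast
  have "Poly_Mapping.keys (c + c') \<subseteq> {V. gset_over (ext_prod B A) V}"
    using c(2) c'(2) keys_add[of c c'] by blast
  then show ?thesis
    unfolding d(1) c'(1) c(1)
    by (simp add: mult_burnside d(2) c'(2) c(2) burnside_comp_coset keys_comp_frag frag_extend2_add_right)
qed

text \<open>\<open>over_class\<close> passes to copies on natural numbers, so the left side is the
  class of the composite of copies. By functoriality that composite is isomorphic to the composite
  of the original spans, whatever their types.\<close>

lemma burnside_comp_over_class: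
  assumes "gset_over (ext_prod C B) V" and "gset_over (ext_prod B A) U"
  shows "burnside_comp A B C (over_class (ext_prod C B) V) (over_class (ext_prod B A) U)
    = over_class (ext_prod C A) (span_comp A B C V U)"
proof -
  note nc = gset_over_nat_copy[OF assms(1)] gset_over_nat_copy[OF assms(2)]
  have "over_iso (ext_prod C A) (span_comp A B C V U) (span_comp A B C (nat_copy V) (nat_copy U))"
    by (intro over_iso_span_comp assms nc over_iso_nat_copy gset_overD(2)[OF assms(1)]
        gset_overD(2)[OF assms(2)])
  then have "over_class (ext_prod C A) (span_comp A B C V U) =
      over_class (ext_prod C A) (span_comp A B C (nat_copy V) (nat_copy U))"
    by (intro over_class_eqI gset_over_span_comp assms nc)
  then show ?thesis
    using nc by (simp add: over_class_def burnside_comp_coset comp_frag_def)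
qed

end

section \<open>Composition of pure tensors\<close>

abbreviation tensor_gens ::
    "('a, 'm) monoid_scheme \<Rightarrow> ('b, 'n) monoid_scheme \<Rightarrow> ('a \<times> 'b \<Rightarrow>\<^sub>0 int) set" where
  "tensor_gens P Q \<equiv>
     {frag_of (p \<otimes>\<^bsub>P\<^esub> p', q) - frag_of (p, q) - frag_of (p', q) |p p' q.
         p \<in> carrier P \<and> p' \<in> carrier P \<and> q \<in> carrier Q} \<union>
     {frag_of (p, q \<otimes>\<^bsub>Q\<^esub> q') - frag_of (p, q) - frag_of (p, q') |p q q'.
         p \<in> carrier P \<and> q \<in> carrier Q \<and> q' \<in> carrier Q}"

lemma tensor_gens_subset:
  assumes P: "\<And>p p'. p \<in> carrier P \<Longrightarrow> p' \<in> carrier P \<Longrightarrow> p \<otimes>\<^bsub>P\<^esub> p' \<in> carrier P"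
    and Q: "\<And>q q'. q \<in> carrier Q \<Longrightarrow> q' \<in> carrier Q \<Longrightarrow> q \<otimes>\<^bsub>Q\<^esub> q' \<in> carrier Q"
  shows "tensor_gens P Q \<subseteq> carrier (tensor_free P Q)"
proof -
  have diff: "frag_of x - frag_of y - frag_of z \<in> carrier (tensor_free P Q)"
    if "x \<in> carrier P \<times> carrier Q" "y \<in> carrier P \<times> carrier Q" "z \<in> carrier P \<times> carrier Q" for x y z
    using that keys_diff[of "frag_of x - frag_of y" "frag_of z"] keys_diff[of "frag_of x" "frag_of y"]
    by auto
  show ?thesis
  proof (intro subsetI, elim UnE CollectE exE conjE)
    fix r p p' q
    assume "r = frag_of (p \<otimes>\<^bsub>P\<^esub> p', q) - frag_of (p, q) - frag_of (p', q)"
      "p \<in> carrier P" "p' \<in> carrier P" "q \<in> carrier Q"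
    then show "r \<in> carrier (tensor_free P Q)" using diff P by simp
  next
    fix r p q q'
    assume "r = frag_of (p, q \<otimes>\<^bsub>Q\<^esub> q') - frag_of (p, q) - frag_of (p, q')"
      "p \<in> carrier P" "q \<in> carrier Q" "q' \<in> carrier Q"
    then show "r \<in> carrier (tensor_free P Q)" using diff Q by simp
  qed
qed

lemma pure_tensor_closed:
  assumes "p \<in> carrier P" "q \<in> carrier Q"
  shows "pure_tensor P Q p q \<in> carrier (tensor P Q)"
  unfolding pure_tensor_def tensor_def carrier_FactGroup using assms by (intro imageI) simp

text \<open>The coset argument of the Burnside level is repeated one level up. A relator in the ring
  variable goes to a relator by distributivity of \<open>R\<close>, one in the Burnside variable by
  biadditivity of \<open>burnside_comp\<close>.\<close>

lemma (in three_groups) cr_comp_pure_tensor: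
  fixes R (structure)
  assumes R: "cring R" and s: "s \<in> carrier R" and r: "r \<in> carrier R"
    and b: "b \<in> carrier (burnside (ext_prod C B))" and a: "a \<in> carrier (burnside (ext_prod B A))"
  shows "cr_comp R A B C (pure_tensor (add_monoid R) (burnside (ext_prod C B)) s b)
      (pure_tensor (add_monoid R) (burnside (ext_prod B A)) r a)
    = pure_tensor (add_monoid R) (burnside (ext_prod C A)) (s \<otimes>\<^bsub>R\<^esub> r) (burnside_comp A B C b a)"
proof -
  interpret R: cring R by (rule R)
  let ?CB = "burnside (ext_prod C B)" and ?BA = "burnside (ext_prod B A)" and ?CA = "burnside (ext_prod C A)"
  define f where "f p q = frag_of (fst p \<otimes>\<^bsub>R\<^esub> fst q, burnside_comp A B C (snd p) (snd q))" for p q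
  have sub: "tensor_gens (add_monoid R) (burnside Z) \<subseteq> carrier (tensor_free (add_monoid R) (burnside Z))"
    for Z :: "('p, 'w) gset"
    by (rule tensor_gens_subset) (simp_all add: burnside_mult_closed)
  have N: "subgroup (tensor_rel (add_monoid R) ?CA) (tensor_free (add_monoid R) ?CA)"
    unfolding tensor_rel_def by (rule generate_free_Abelian_group_subgroup[OF sub])
  have rel1: "frag_of (p \<oplus>\<^bsub>R\<^esub> p', q) - frag_of (p, q) - frag_of (p', q) \<in> tensor_rel (add_monoid R) ?CA"
    if "p \<in> carrier R" "p' \<in> carrier R" "q \<in> carrier ?CA" for p p' q
    unfolding tensor_rel_def by (rule generate.incl) (use that in force)
  have rel2: "frag_of (p, q \<otimes>\<^bsub>?CA\<^esub> q') - frag_of (p, q) - frag_of (p, q') \<in> tensor_rel (add_monoid R) ?CA"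
    if "p \<in> carrier R" "q \<in> carrier ?CA" "q' \<in> carrier ?CA" for p q q'
    unfolding tensor_rel_def by (rule generate.incl) (use that in force)
  have left: "frag_extend (\<lambda>p. f p q) t \<in> tensor_rel (add_monoid R) ?CA"
    if t: "t \<in> tensor_gens (add_monoid R) ?CB" and q: "q \<in> carrier (add_monoid R) \<times> carrier ?BA" for t q
  proof -
    obtain u c where q: "q = (u, c)" "u \<in> carrier R" "c \<in> carrier ?BA" using q by auto
    from t consider p p' d where "t = frag_of (p \<oplus>\<^bsub>R\<^esub> p', d) - frag_of (p, d) - frag_of (p', d)"
        "p \<in> carrier R" "p' \<in> carrier R" "d \<in> carrier ?CB"
      | p d d' where "t = frag_of (p, d \<otimes>\<^bsub>?CB\<^esub> d') - frag_of (p, d) - frag_of (p, d')"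
        "p \<in> carrier R" "d \<in> carrier ?CB" "d' \<in> carrier ?CB" by auto
    then show ?thesis
    proof cases
      case 1
      then show ?thesis using q rel1[of "p \<otimes>\<^bsub>R\<^esub> u" "p' \<otimes>\<^bsub>R\<^esub> u" "burnside_comp A B C d c"]
        by (simp add: frag_extend_diff f_def R.l_distr burnside_comp_closed)
    next
      case 2
      then show ?thesis
        using q rel2[of "p \<otimes>\<^bsub>R\<^esub> u" "burnside_comp A B C d c" "burnside_comp A B C d' c"]
        by (simp add: frag_extend_diff f_def burnside_comp_mult_left burnside_comp_closed)
    qed
  qed
  have right: "frag_extend (f q) t \<in> tensor_rel (add_monoid R) ?CA"
    if t: "t \<in> tensor_gens (add_monoid R) ?BA" and q: "q \<in> carrier (add_monoid R) \<times> carrier ?CB" for t q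
  proof -
    obtain u c where q: "q = (u, c)" "u \<in> carrier R" "c \<in> carrier ?CB" using q by auto
    from t consider p p' d where "t = frag_of (p \<oplus>\<^bsub>R\<^esub> p', d) - frag_of (p, d) - frag_of (p', d)"
        "p \<in> carrier R" "p' \<in> carrier R" "d \<in> carrier ?BA"
      | p d d' where "t = frag_of (p, d \<otimes>\<^bsub>?BA\<^esub> d') - frag_of (p, d) - frag_of (p, d')"
        "p \<in> carrier R" "d \<in> carrier ?BA" "d' \<in> carrier ?BA" by auto
    then show ?thesis
    proof cases
      case 1
      then show ?thesis using q rel1[of "u \<otimes>\<^bsub>R\<^esub> p" "u \<otimes>\<^bsub>R\<^esub> p'" "burnside_comp A B C c d"]
        by (simp add: frag_extend_diff f_def R.r_distr burnside_comp_closed)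
    next
      case 2
      then show ?thesis
        using q rel2[of "u \<otimes>\<^bsub>R\<^esub> p" "burnside_comp A B C c d" "burnside_comp A B C c d'"]
        by (simp add: frag_extend_diff f_def burnside_comp_mult_right burnside_comp_closed)
    qed
  qed
  have "Poly_Mapping.keys (frag_of (s, b)) \<subseteq> carrier (add_monoid R) \<times> carrier ?CB"
    "Poly_Mapping.keys (frag_of (r, a)) \<subseteq> carrier (add_monoid R) \<times> carrier ?BA"
    using s r a b by simp_all
  then have "(\<Union>d\<in>tensor_rel (add_monoid R) ?CB #>\<^bsub>tensor_free (add_monoid R) ?CB\<^esub> frag_of (s, b).
      \<Union>c\<in>tensor_rel (add_monoid R) ?BA #>\<^bsub>tensor_free (add_monoid R) ?BA\<^esub> frag_of (r, a).
        tensor_rel (add_monoid R) ?CA #>\<^bsub>tensor_free (add_monoid R) ?CA\<^esub> frag_extend2 f d c) =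
      tensor_rel (add_monoid R) ?CA #>\<^bsub>tensor_free (add_monoid R) ?CA\<^esub>
        frag_extend2 f (frag_of (s, b)) (frag_of (r, a))"
    unfolding tensor_rel_def[of _ ?CB] tensor_rel_def[of _ ?BA]
    by (intro frag_extend2_cosets[OF sub sub N]) (rule left right; assumption)+
  \<comment> \<open>\<open>cr_comp_def\<close> matches on pairs while \<open>f\<close> uses
    projections; this identifies the two forms.\<close>
  moreover have "(\<lambda>(s, b). frag_extend (\<lambda>(r, a). frag_of (s \<otimes>\<^bsub>R\<^esub> r, burnside_comp A B C b a)) c) =
      (\<lambda>v. frag_extend (f v) c)" for c
    by (simp add: f_def[abs_def] case_prod_unfold)
  moreover have "f (s, b) (r, a) = frag_of (s \<otimes>\<^bsub>R\<^esub> r, burnside_comp A B C b a)" by (simp add: f_def)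
  ultimately show ?thesis
    unfolding cr_comp_def pure_tensor_def frag_extend2_of frag_extend2_def by simp
qed

section \<open>Principal spans\<close>

lemma gset_over_id_span:
  assumes act: "group_action (grp A) (pts A) (gact A)"
    and fin: "finite (carrier (grp A))" "finite (pts A)"
  shows "gset_over (ext_prod A A) (id_span A)"
proof -
  interpret action: group_action "grp A" "pts A" "gact A" by (rule act)
  interpret group "grp A" using action.group_hom group_hom.axioms(1) by blast
  have closed: "gact A g y \<in> pts A" if "g \<in> carrier (grp A)" "y \<in> pts A" for g y
    using action.element_image that by blast
  have one: "gact A \<one>\<^bsub>grp A\<^esub> y = y" if "y \<in> pts A" for y
    using that by (simp add: action.id_eq_one[symmetric])
  show ?thesis
    by (rule gset_over_ext_prodI)
      (auto simp: id_span_def fin closed one action.composition_rule[symmetric] m_assoc inv_mult_group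
        inv_solve_left is_group)
qed

text \<open>The opposite biset. Both groups are encoded as acting from the left, so exchanging their
  roles introduces no inverses.\<close>

definition span_op :: "('h \<times> 'g, 'u, 'y \<times> 'x) slice \<Rightarrow> ('g \<times> 'h, 'u, 'x \<times> 'y) slice" where
  "span_op U = \<lparr>tot = tot U, act = (\<lambda>(g, h). act U (h, g)), proj = (\<lambda>u. (snd (proj U u), fst (proj U u)))\<rparr>"

lemma span_op_simps [simp]:
  "tot (span_op U) = tot U" "act (span_op U) (g, h) = act U (h, g)"
  "fst (proj (span_op U) u) = snd (proj U u)" "snd (proj (span_op U) u) = fst (proj U u)"
  by (simp_all add: span_op_def)

lemma span_op_span_op [simp]: "span_op (span_op U) = U"
  by (simp add: span_op_def case_prod_unfold)

lemma gset_over_span_op: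
  assumes "group (grp A)" "group (grp B)" "gset_over (ext_prod B A) U"
  shows "gset_over (ext_prod A B) (span_op U)"
  by (rule gset_over_ext_prodI) (simp_all add: assms(1,2) gset_over_ext_prodD[OF assms(3)])

text \<open>For an \<open>(H \<times> G)\<close>-set \<open>U\<close> over \<open>Y \<times> X\<close>: \<open>U \<rightarrow> X\<close> is a principal \<open>H\<close>-bundle.\<close>

definition left_principal :: "('h, 'y) gset \<Rightarrow> ('g, 'x) gset \<Rightarrow> ('h \<times> 'g, 'u, 'y \<times> 'x) slice \<Rightarrow> bool" where
  "left_principal B A U \<longleftrightarrow>
     gset_over (ext_prod B A) U \<and>
     (\<forall>a \<in> pts A. \<exists>u \<in> tot U. snd (proj U u) = a) \<and>
     (\<forall>u \<in> tot U. \<forall>u' \<in> tot U. snd (proj U u) = snd (proj U u') \<longrightarrow>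
        (\<exists>!h. h \<in> carrier (grp B) \<and> act U (h, \<one>\<^bsub>grp A\<^esub>) u = u'))"

text \<open>The hypothesis \<open>right\<close> defines the difference \<open>d v u\<close>: entries
  of a matching pair have the same image in \<open>pts B\<close>, so a unique element of
  \<open>grp A\<close> carries \<open>u\<close> to \<open>v\<close>. The hypothesis
  \<open>left\<close> gives bijectivity: every point of \<open>pts A\<close> is hit, and elements
  over the same point differ by an element of \<open>grp B\<close>.\<close>

lemma over_iso_span_comp_op:
  assumes act: "group_action (grp A) (pts A) (gact A)" and grpB: "group (grp B)"
    and left: "left_principal B A U" and right: "left_principal A B (span_op U)"
  shows "over_iso (ext_prod A A) (span_comp A B A (span_op U) U) (id_span A)"
proof -
  interpret action: group_action "grp A" "pts A" "gact A" by (rule act)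
  have grpA: "group (grp A)" using action.group_hom group_hom.axioms(1) by blast
  have U: "gset_over (ext_prod B A) U" using left by (simp add: left_principal_def)
  interpret composable_spans A B A "span_op U" U
    by (intro composable_spans.intro three_groups.intro composable_spans_axioms.intro
        gset_over_span_op grpA grpB U)
  define d where "d v u = (THE g. g \<in> carrier (grp A) \<and> act U (\<one>\<^bsub>grp B\<^esub>, g) u = v)" for v u
  have ex1: "\<exists>!g. g \<in> carrier (grp A) \<and> act U (\<one>\<^bsub>grp B\<^esub>, g) u = v"
    if "v \<in> tot U" "u \<in> tot U" "fst (proj U v) = fst (proj U u)" for v u
    using right that by (simp add: left_principal_def)
  have d: "d v u \<in> carrier (grp A)" "act U (\<one>\<^bsub>grp B\<^esub>, d v u) u = v"
    if "v \<in> tot U" "u \<in> tot U" "fst (proj U v) = fst (proj U u)" for v u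
    using theI'[OF ex1[OF that]] by (simp_all add: d_def)
  \<comment> \<open>Acting by \<open>g\<close> alone does not change the image in
    \<open>pts B\<close>, so \<open>ex1\<close> applies. Values of \<open>d\<close> are found below
    by bringing the first entry into this form.\<close>
  have d_eq: "d (act U (\<one>\<^bsub>grp B\<^esub>, g) u) u = g" if "g \<in> carrier (grp A)" "u \<in> tot U" for g u
    unfolding d_def
    by (rule the1_equality[OF ex1]) (use that actU(8)[of "\<one>\<^bsub>grp B\<^esub>" "\<one>\<^bsub>grp A\<^esub>" u] in
        \<open>simp_all add: actU(3,4,8)\<close>)
  show ?thesis
  proof (rule over_iso_compI[where f = "\<lambda>v u. (d v u, snd (proj U v))"])
    fix v u assume "pair v u"
    then have p: "v \<in> tot U" "u \<in> tot U" "fst (proj U v) = fst (proj U u)" by simp_all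
    show "(d v u, snd (proj U v)) \<in> tot (id_span A)"
      using p by (simp add: id_span_def d actU(7))
    have "snd (proj U v) = gact A (d v u) (snd (proj U u))"
      using actU(9)[of "\<one>\<^bsub>grp B\<^esub>" "d v u" u] p by (simp add: d)
    then have "gact A (inv\<^bsub>grp A\<^esub> (d v u)) (snd (proj U v)) = snd (proj U u)"
      using action.orbit_sym_aux d(1)[OF p] actU(7)[OF p(2)] by simp
    then show "proj (id_span A) (d v u, snd (proj U v)) = (fst (proj (span_op U) v), snd (proj U u))"
      by (simp add: id_span_def)
    show "(d (act (span_op U) (\<one>\<^bsub>grp A\<^esub>, h) v) (act U (h, \<one>\<^bsub>grp A\<^esub>) u),
        snd (proj U (act (span_op U) (\<one>\<^bsub>grp A\<^esub>, h) v))) = (d v u, snd (proj U v))"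
      if h: "h \<in> carrier (grp B)" for h
    proof -
      \<comment> \<open>The actions of \<open>h\<close> and of \<open>d v u\<close> on
        \<open>U\<close> commute, so moving both entries by \<open>h\<close> leaves their difference
        unchanged.\<close>
      have "act U (h, \<one>\<^bsub>grp A\<^esub>) v = act U (h, \<one>\<^bsub>grp A\<^esub>) (act U (\<one>\<^bsub>grp B\<^esub>, d v u) u)"
        by (simp add: d(2)[OF p])
      also have "\<dots> = act U (\<one>\<^bsub>grp B\<^esub>, d v u) (act U (h, \<one>\<^bsub>grp A\<^esub>) u)"
        using h p d(1)[OF p] by (simp add: actU(5))
      finally have "d (act U (h, \<one>\<^bsub>grp A\<^esub>) v) (act U (h, \<one>\<^bsub>grp A\<^esub>) u) = d v u"
        using h p d(1)[OF p] by (simp add: d_eq actU(3))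
      then show ?thesis using h p(1) by (simp add: proj_act_middle)
    qed
    show "act (id_span A) (k, g) (d v u, snd (proj U v)) =
        (d (act (span_op U) (k, \<one>\<^bsub>grp B\<^esub>) v) (act U (\<one>\<^bsub>grp B\<^esub>, g) u),
         snd (proj U (act (span_op U) (k, \<one>\<^bsub>grp B\<^esub>) v)))"
      if k: "k \<in> carrier (grp A)" and g: "g \<in> carrier (grp A)" for k g
    proof -
      \<comment> \<open>From \<open>v = d u\<close>, with \<open>d\<close> for \<open>d v u\<close>,
        follows \<open>k v = (k d g^-1) (g u)\<close>; this is the action on the first coordinate of
        the identity span.\<close>
      let ?e = "k \<otimes>\<^bsub>grp A\<^esub> d v u \<otimes>\<^bsub>grp A\<^esub> inv\<^bsub>grp A\<^esub> g"
      have "act U (\<one>\<^bsub>grp B\<^esub>, k) v = act U (\<one>\<^bsub>grp B\<^esub>, k) (act U (\<one>\<^bsub>grp B\<^esub>, d v u) u)"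
        by (simp add: d(2)[OF p])
      also have "\<dots> = act U (\<one>\<^bsub>grp B\<^esub>, ?e) (act U (\<one>\<^bsub>grp B\<^esub>, g) u)"
        using k g p d(1)[OF p] by (simp add: actU(5) A.m_assoc)
      finally have "d (act U (\<one>\<^bsub>grp B\<^esub>, k) v) (act U (\<one>\<^bsub>grp B\<^esub>, g) u) = ?e"
        using k g p d(1)[OF p] by (simp add: d_eq actU(3))
      then show ?thesis
        using k p d(1)[OF p] by (simp add: id_span_def actU(7,9))
    qed
    fix v' u' assume "pair v' u'"
      and eq: "(d v u, snd (proj U v)) = (d v' u', snd (proj U v'))"
    then have p': "v' \<in> tot U" "u' \<in> tot U" "fst (proj U v') = fst (proj U u')" by simp_all
    \<comment> \<open>The common point of \<open>pts A\<close> yields \<open>h\<close> with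
      \<open>h v = v'\<close>. As \<open>u\<close> is the translate of \<open>v\<close> by the
      inverse of \<open>d v u\<close>, and the two differences agree, the same \<open>h\<close>
      carries \<open>u\<close> to \<open>u'\<close>.\<close>
    obtain h where h: "h \<in> carrier (grp B)" "act U (h, \<one>\<^bsub>grp A\<^esub>) v = v'"
      using left p(1) p'(1) eq unfolding left_principal_def by blast
    have u: "act U (\<one>\<^bsub>grp B\<^esub>, inv\<^bsub>grp A\<^esub> (d v u)) v = u"
      if p: "v \<in> tot U" "u \<in> tot U" "fst (proj U v) = fst (proj U u)" for v u
      using actU(5)[of "\<one>\<^bsub>grp B\<^esub>" "inv\<^bsub>grp A\<^esub> (d v u)" "\<one>\<^bsub>grp B\<^esub>" "d v u" u] p
      by (simp add: d[OF p] actU(4))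
    have "act U (h, \<one>\<^bsub>grp A\<^esub>) u = act U (h, \<one>\<^bsub>grp A\<^esub>) (act U (\<one>\<^bsub>grp B\<^esub>, inv\<^bsub>grp A\<^esub> (d v u)) v)"
      by (simp add: u[OF p])
    also have "\<dots> = act U (\<one>\<^bsub>grp B\<^esub>, inv\<^bsub>grp A\<^esub> (d v' u')) (act U (h, \<one>\<^bsub>grp A\<^esub>) v)"
      using h(1) p eq d(1)[OF p] by (simp add: actU(5))
    also have "\<dots> = u'" by (simp add: h(2) u[OF p'])
    finally show "\<exists>h\<in>carrier (grp B). v' = act (span_op U) (\<one>\<^bsub>grp A\<^esub>, h) v \<and> u' = act U (h, \<one>\<^bsub>grp A\<^esub>) u"
      using h by (intro bexI[of _ h]) simp_all
  next
    fix t assume "t \<in> tot (id_span A)"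
    then obtain g a where t: "t = (g, a)" and g: "g \<in> carrier (grp A)" and a: "a \<in> pts A"
      by (auto simp: id_span_def)
    obtain v where v: "v \<in> tot U" "snd (proj U v) = a"
      using left a unfolding left_principal_def by blast
    \<comment> \<open>The difference is to be \<open>g\<close>, which forces the second entry to be
      the translate of \<open>v\<close> by \<open>inv g\<close>.\<close>
    let ?u = "act U (\<one>\<^bsub>grp B\<^esub>, inv\<^bsub>grp A\<^esub> g) v"
    have u: "?u \<in> tot U" using v g by (simp add: actU(3))
    have gu: "act U (\<one>\<^bsub>grp B\<^esub>, g) ?u = v" using v g by (simp add: actU(4,5))
    have "fst (proj U v) = fst (proj U ?u)"
      using actU(8)[of "\<one>\<^bsub>grp B\<^esub>" "\<one>\<^bsub>grp A\<^esub>" v] v g by (simp add: actU(4,8))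
    moreover have "d v ?u = g" using d_eq[OF g u] by (simp add: gu)
    ultimately show "\<exists>v u. pair v u \<and> (d v u, snd (proj U v)) = t"
      using v u t by (intro exI[of _ v] exI[of _ ?u]) simp
  qed
qed

text \<open>The two principality conditions are exchanged when \<open>A\<close> and \<open>B\<close>
  are swapped and \<open>U\<close> is replaced by its opposite. As \<open>span_op\<close> is an
  involution, one computation of a composite gives both identities.\<close>

lemma cr_isomorphic_if_principal:
  fixes R (structure)
  assumes R: "cring R"
    and A: "group_action (grp A) (pts A) (gact A)" "finite (carrier (grp A))" "finite (pts A)"
    and B: "group_action (grp B) (pts B) (gact B)" "finite (carrier (grp B))" "finite (pts B)"
    and left: "left_principal B A U" and right: "left_principal A B (span_op U)"
  shows "cr_isomorphic R A B"
proof -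
  interpret R: cring R by (rule R)
  have grpA: "group (grp A)" and grpB: "group (grp B)"
    using A(1) B(1) group_action.group_hom group_hom.axioms(1) by blast+
  interpret ABA: three_groups A B A by (rule three_groups.intro[OF grpA grpB grpA])
  interpret BAB: three_groups B A B by (rule three_groups.intro[OF grpB grpA grpB])
  have U: "gset_over (ext_prod B A) U" "gset_over (ext_prod A B) (span_op U)"
    using left right by (simp_all add: left_principal_def)
  define \<phi> where "\<phi> = pure_tensor (add_monoid R) (burnside (ext_prod B A)) \<one>\<^bsub>R\<^esub> (over_class (ext_prod B A) U)"
  define \<psi> where
    "\<psi> = pure_tensor (add_monoid R) (burnside (ext_prod A B)) \<one>\<^bsub>R\<^esub> (over_class (ext_prod A B) (span_op U))"
  have "cr_comp R A B A \<psi> \<phi> = cr_id R A"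
    unfolding \<phi>_def \<psi>_def cr_id_def
      ABA.cr_comp_pure_tensor[OF R R.one_closed R.one_closed over_class_closed[OF U(2)] over_class_closed[OF U(1)]]
      ABA.burnside_comp_over_class[OF U(2,1)]
      over_class_eqI[OF ABA.gset_over_span_comp[OF U(2,1)] gset_over_id_span[OF A]
        over_iso_span_comp_op[OF A(1) grpB left right]]
    by simp
  moreover have "over_iso (ext_prod B B) (span_comp B A B U (span_op U)) (id_span B)"
    using over_iso_span_comp_op[OF B(1) grpA right] left by simp
  then have "cr_comp R B A B \<phi> \<psi> = cr_id R B"
    unfolding \<phi>_def \<psi>_def cr_id_def
      BAB.cr_comp_pure_tensor[OF R R.one_closed R.one_closed over_class_closed[OF U(1)] over_class_closed[OF U(2)]]
      BAB.burnside_comp_over_class[OF U]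
    by (simp add: over_class_eqI[OF BAB.gset_over_span_comp[OF U] gset_over_id_span[OF B]])
  moreover have "\<phi> \<in> carrier (cr_hom R A B)" "\<psi> \<in> carrier (cr_hom R B A)"
    unfolding \<phi>_def \<psi>_def cr_hom_def by (simp_all add: pure_tensor_closed over_class_closed U)
  ultimately show ?thesis unfolding cr_isomorphic_def by blast
qed

section \<open>Orbit decomposition\<close>

text \<open>An elementwise form of the orbit decomposition, cut to the use made of it:
  \<open>rep_ex\<close> makes the fibres over \<open>E\<close> nonempty, and
  \<open>rep_unique\<close> keeps each fibre within one index.\<close>

locale orbit_representatives = group_action G E \<phi>
  for G :: "'g monoid" (structure) and E :: "'x set" and \<phi> :: "'g \<Rightarrow> 'x \<Rightarrow> 'x" +
  fixes I :: "'i set" and rep :: "'i \<Rightarrow> 'x"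
  assumes finite_G: "finite (carrier G)" and finite_I: "finite I"
    and rep_in: "i \<in> I \<Longrightarrow> rep i \<in> E"
    and rep_ex: "y \<in> E \<Longrightarrow> \<exists>i\<in>I. \<exists>g\<in>carrier G. \<phi> g (rep i) = y"
    and rep_unique: "i \<in> I \<Longrightarrow> j \<in> I \<Longrightarrow> g \<in> carrier G \<Longrightarrow> h \<in> carrier G \<Longrightarrow>
      \<phi> g (rep i) = \<phi> h (rep j) \<Longrightarrow> i = j"
begin

sublocale group G using group_hom group_hom.axioms(1) by blast

abbreviation A :: "('g, 'x) gset" where "A \<equiv> \<lparr>grp = G, pts = E, gact = \<phi>\<rparr>"

abbreviation S :: "'i \<Rightarrow> 'g set" where "S i \<equiv> stabilizer G \<phi> (rep i)"

abbreviation B :: "('i \<Rightarrow> 'g, 'i \<times> unit \<times> ('i \<Rightarrow> 'g)) gset" where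
  "B \<equiv> dir_sum I (\<lambda>i. point (G\<lparr>carrier := S i\<rparr>))"

text \<open>On the piece with index \<open>i\<close>, the coordinate \<open>p i\<close> translates
  \<open>G\<close> from the right, through its inverse so that a left action results. Every other
  coordinate \<open>p j\<close> translates its own factor from the left. The element
  \<open>a\<close> acts on \<open>G\<close> only.\<close>

definition bibundle :: "(('i \<Rightarrow> 'g) \<times> 'g, 'i \<times> 'g \<times> ('i \<Rightarrow> 'g), ('i \<times> unit \<times> ('i \<Rightarrow> 'g)) \<times> 'x) slice" where
  "bibundle = (let T = SIGMA i:I. carrier G \<times> (\<Pi>\<^sub>E j\<in>I - {i}. S j) in
     \<lparr>tot = T,
      act = (\<lambda>(p, a). \<lambda>(i, g, t)\<in>T. (i, a \<otimes>\<^bsub>G\<^esub> g \<otimes>\<^bsub>G\<^esub> inv\<^bsub>G\<^esub> (p i), \<lambda>j\<in>I - {i}. p j \<otimes>\<^bsub>G\<^esub> t j)),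
      proj = (\<lambda>(i, g, t). ((i, (), t), \<phi> g (rep i)))\<rparr>)"

lemma S_subgroup: "i \<in> I \<Longrightarrow> subgroup (S i) G"
  using stabilizer_subgroup rep_in by blast

lemma S_D: "g \<in> S i \<Longrightarrow> g \<in> carrier G" "g \<in> S i \<Longrightarrow> \<phi> g (rep i) = rep i"
  by (simp_all add: stabilizer_def)

lemma S_closed:
  assumes "i \<in> I"
  shows "\<one> \<in> S i" "g \<in> S i \<Longrightarrow> h \<in> S i \<Longrightarrow> g \<otimes> h \<in> S i" "g \<in> S i \<Longrightarrow> inv g \<in> S i"
  using S_subgroup[OF assms] by (simp_all add: subgroup.one_closed subgroup.m_closed subgroup.m_inv_closed)

lemma grp_B: "carrier (grp B) = (\<Pi>\<^sub>E i\<in>I. S i)" "\<one>\<^bsub>grp B\<^esub> = (\<lambda>i\<in>I. \<one>)"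
  "p \<otimes>\<^bsub>grp B\<^esub> q = (\<lambda>i\<in>I. p i \<otimes> q i)"
  by (simp_all add: dir_sum_def Let_def point_def)

lemma group_B: "group (grp B)"
proof -
  have "group (G\<lparr>carrier := S i\<rparr>)" if "i \<in> I" for i
    using S_subgroup[OF that] subgroup.subgroup_is_group is_group by blast
  then show ?thesis by (simp add: dir_sum_def Let_def point_def)
qed

lemma pts_B: "pts B = (SIGMA i:I. {()} \<times> (\<Pi>\<^sub>E j\<in>I - {i}. S j))"
  by (simp add: dir_sum_def Let_def point_def)

lemma gact_B:
  "gact B p = (\<lambda>(i, u, t)\<in>pts B. (i, (), \<lambda>j\<in>I - {i}. p j \<otimes> t j))"
  by (auto simp: dir_sum_def Let_def point_def fun_eq_iff)

lemma finite_S: "finite (S i)"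
  using finite_G by (rule finite_subset[rotated]) (auto simp: stabilizer_def)

lemma finite_B: "finite (carrier (grp B))" "finite (pts B)"
  unfolding grp_B pts_B using finite_I finite_S by (auto intro!: finite_PiE finite_SigmaI)

text \<open>Translation of the coordinates other than \<open>i\<close> occurs both in the direct sum
  and in \<open>bibundle\<close>; this and the next two lemmas serve both.\<close>

lemma translate:
  assumes p: "p \<in> (\<Pi>\<^sub>E i\<in>I. S i)" and t: "t \<in> (\<Pi>\<^sub>E j\<in>I - {i}. S j)"
  shows "(\<lambda>j\<in>I - {i}. p j \<otimes> t j) \<in> (\<Pi>\<^sub>E j\<in>I - {i}. S j)"
  using p t S_closed(2) by (auto simp: PiE_iff)

lemma translate_one:
  assumes "t \<in> (\<Pi>\<^sub>E j\<in>I - {i}. S j)"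
  shows "(\<lambda>j\<in>I - {i}. (\<lambda>i\<in>I. \<one>) j \<otimes> t j) = t"
proof
  fix j
  have "t j \<in> carrier G" if "j \<in> I - {i}" using PiE_mem[OF assms that] by (rule S_D(1))
  then show "(\<lambda>j\<in>I - {i}. (\<lambda>i\<in>I. \<one>) j \<otimes> t j) j = t j"
    using PiE_arb[OF assms, of j] by (cases "j \<in> I - {i}") auto
qed

lemma translate_mult:
  assumes "p \<in> (\<Pi>\<^sub>E i\<in>I. S i)" "q \<in> (\<Pi>\<^sub>E i\<in>I. S i)" "t \<in> (\<Pi>\<^sub>E j\<in>I - {i}. S j)"
  shows "(\<lambda>j\<in>I - {i}. (\<lambda>i\<in>I. p i \<otimes> q i) j \<otimes> t j) = (\<lambda>j\<in>I - {i}. p j \<otimes> (\<lambda>j\<in>I - {i}. q j \<otimes> t j) j)"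
proof (rule restrict_ext)
  fix j assume j: "j \<in> I - {i}"
  then have jI: "j \<in> I" by simp
  note S_D(1)[OF PiE_mem[OF assms(1) jI]] S_D(1)[OF PiE_mem[OF assms(2) jI]]
    S_D(1)[OF PiE_mem[OF assms(3) j]]
  then show "(\<lambda>i\<in>I. p i \<otimes> q i) j \<otimes> t j = p j \<otimes> (\<lambda>j\<in>I - {i}. q j \<otimes> t j) j"
    using j jI by (simp add: m_assoc)
qed

lemma action_B: "group_action (grp B) (pts B) (gact B)"
proof (rule group_actionI[OF group_B])
  fix p assume "p \<in> carrier (grp B)"
  show "gact B p \<in> extensional (pts B)" by (simp add: gact_B)
next
  fix p y assume p: "p \<in> carrier (grp B)" and "y \<in> pts B"
  then obtain i t where "y = (i, (), t)" "i \<in> I" "t \<in> (\<Pi>\<^sub>E j\<in>I - {i}. S j)"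
    unfolding pts_B by blast
  then show "gact B p y \<in> pts B"
    using p translate[of p t i] by (simp add: gact_B pts_B grp_B)
next
  fix y assume "y \<in> pts B"
  then obtain i t where "y = (i, (), t)" "i \<in> I" "t \<in> (\<Pi>\<^sub>E j\<in>I - {i}. S j)"
    unfolding pts_B by blast
  then show "gact B \<one>\<^bsub>grp B\<^esub> y = y"
    using translate_one[of t i] by (simp add: gact_B pts_B grp_B)
next
  fix p q y assume pq: "p \<in> carrier (grp B)" "q \<in> carrier (grp B)" and "y \<in> pts B"
  then obtain i t where "y = (i, (), t)" "i \<in> I" "t \<in> (\<Pi>\<^sub>E j\<in>I - {i}. S j)"
    unfolding pts_B by blast
  then show "gact B (p \<otimes>\<^bsub>grp B\<^esub> q) y = gact B p (gact B q y)"
    using pq translate[of q t i] translate_mult[of p q t i] by (simp add: gact_B pts_B grp_B)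
qed

lemma tot_bibundle: "tot bibundle = (SIGMA i:I. carrier G \<times> (\<Pi>\<^sub>E j\<in>I - {i}. S j))"
  by (simp add: bibundle_def Let_def)

lemma proj_bibundle: "proj bibundle (i, g, t) = ((i, (), t), \<phi> g (rep i))"
  by (simp add: bibundle_def Let_def)

lemma act_bibundle:
  assumes "(i, g, t) \<in> tot bibundle"
  shows "act bibundle (p, a) (i, g, t) = (i, a \<otimes> g \<otimes> inv (p i), \<lambda>j\<in>I - {i}. p j \<otimes> t j)"
  using assms unfolding tot_bibundle by (simp add: bibundle_def Let_def)

lemma tot_bibundleE:
  assumes "u \<in> tot bibundle"
  obtains i g t where "u = (i, g, t)" "i \<in> I" "g \<in> carrier G" "t \<in> (\<Pi>\<^sub>E j\<in>I - {i}. S j)"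
  using assms unfolding tot_bibundle by blast

lemma act_bibundle_closed:
  assumes "i \<in> I" "g \<in> carrier G" "t \<in> (\<Pi>\<^sub>E j\<in>I - {i}. S j)" "p \<in> (\<Pi>\<^sub>E i\<in>I. S i)" "a \<in> carrier G"
  shows "(i, a \<otimes> g \<otimes> inv (p i), \<lambda>j\<in>I - {i}. p j \<otimes> t j) \<in> tot bibundle"
  using assms translate[of p t i] S_D(1)[of "p i" i] by (auto simp: tot_bibundle PiE_iff)

lemma gset_over_bibundle: "gset_over (ext_prod B A) bibundle"
proof (rule gset_over_ext_prodI[OF group_B])
  show "group (grp A)" using is_group by simp
  show "finite (tot bibundle)"
    unfolding tot_bibundle using finite_I finite_S finite_G by (auto intro!: finite_PiE finite_SigmaI)
next
  fix p a assume "p \<in> carrier (grp B)" "a \<in> carrier (grp A)"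
  show "act bibundle (p, a) \<in> extensional (tot bibundle)" by (simp add: bibundle_def Let_def)
next
  fix p a u assume pa: "p \<in> carrier (grp B)" "a \<in> carrier (grp A)" and "u \<in> tot bibundle"
  then obtain i g t where u: "u = (i, g, t)" "i \<in> I" "g \<in> carrier G" "t \<in> (\<Pi>\<^sub>E j\<in>I - {i}. S j)"
    using tot_bibundleE by blast
  have pi: "p i \<in> S i" using pa(1) u(2) by (auto simp: grp_B PiE_iff)
  have act: "act bibundle (p, a) u = (i, a \<otimes> g \<otimes> inv (p i), \<lambda>j\<in>I - {i}. p j \<otimes> t j)"
    using \<open>u \<in> tot bibundle\<close> unfolding u(1) by (rule act_bibundle)
  show "act bibundle (p, a) u \<in> tot bibundle"
    unfolding act using u pa act_bibundle_closed by (simp add: grp_B)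
  show "fst (proj bibundle (act bibundle (p, a) u)) = gact B p (fst (proj bibundle u))"
    unfolding act using u by (simp add: proj_bibundle gact_B pts_B)
  \<comment> \<open>Here the stabilizers matter: right translation by \<open>inv (p i)\<close> does
    not change the point \<open>\<phi> g (rep i)\<close>.\<close>
  have "\<phi> (inv (p i)) (rep i) = rep i" using S_closed(3)[OF u(2) pi] S_D(2) by blast
  then show "snd (proj bibundle (act bibundle (p, a) u)) = gact A a (snd (proj bibundle u))"
    unfolding act using u pa pi S_D(1)[OF pi] rep_in[OF u(2)]
    by (simp add: proj_bibundle composition_rule m_assoc)
next
  fix u assume "u \<in> tot bibundle"
  then obtain i g t where u: "u = (i, g, t)" "i \<in> I" "g \<in> carrier G" "t \<in> (\<Pi>\<^sub>E j\<in>I - {i}. S j)"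
    using tot_bibundleE by blast
  show "act bibundle (\<one>\<^bsub>grp B\<^esub>, \<one>\<^bsub>grp A\<^esub>) u = u"
    using \<open>u \<in> tot bibundle\<close> u translate_one[OF u(4)] unfolding u(1)
    by (simp add: act_bibundle grp_B)
  show "fst (proj bibundle u) \<in> pts B" "snd (proj bibundle u) \<in> pts A"
    using u element_image[OF u(3) rep_in[OF u(2)] refl] by (simp_all add: proj_bibundle pts_B)
next
  fix p a q b u
  assume pa: "p \<in> carrier (grp B)" "a \<in> carrier (grp A)" "q \<in> carrier (grp B)" "b \<in> carrier (grp A)"
    and uE: "u \<in> tot bibundle"
  then obtain i g t where u: "u = (i, g, t)" "i \<in> I" "g \<in> carrier G" "t \<in> (\<Pi>\<^sub>E j\<in>I - {i}. S j)"
    using tot_bibundleE by blast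
  have pi: "p i \<in> carrier G" "q i \<in> carrier G" using pa(1,3) u(2) S_D(1) by (auto simp: grp_B PiE_iff)
  have "act bibundle (p, a) (act bibundle (q, b) u) =
      (i, a \<otimes> (b \<otimes> g \<otimes> inv (q i)) \<otimes> inv (p i), \<lambda>j\<in>I - {i}. p j \<otimes> (\<lambda>j\<in>I - {i}. q j \<otimes> t j) j)"
    using uE act_bibundle_closed[OF u(2-4), of q b] pa unfolding u(1)
    by (simp add: act_bibundle grp_B)
  moreover have "act bibundle (p \<otimes>\<^bsub>grp B\<^esub> q, a \<otimes> b) u =
      (i, a \<otimes> b \<otimes> g \<otimes> inv (p i \<otimes> q i), \<lambda>j\<in>I - {i}. (\<lambda>i\<in>I. p i \<otimes> q i) j \<otimes> t j)"
    using uE u(2) unfolding u(1) by (simp add: act_bibundle grp_B)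
  moreover have "a \<otimes> b \<otimes> g \<otimes> inv (p i \<otimes> q i) = a \<otimes> (b \<otimes> g \<otimes> inv (q i)) \<otimes> inv (p i)"
    using pa(2,4) u(3) pi by (simp add: inv_mult_group m_assoc)
  ultimately show "act bibundle (p \<otimes>\<^bsub>grp B\<^esub> q, a \<otimes>\<^bsub>grp A\<^esub> b) u = act bibundle (p, a) (act bibundle (q, b) u)"
    using translate_mult[of p q t i] pa u(4) by (simp add: grp_B)
qed

section \<open>Both legs of the span are principal\<close>

lemma left_principal_bibundle: "left_principal B A bibundle"
  unfolding left_principal_def
proof (intro conjI ballI impI gset_over_bibundle)
  fix a assume "a \<in> pts A"
  then obtain i g where ig: "i \<in> I" "g \<in> carrier G" "\<phi> g (rep i) = a"
    using rep_ex[of a] by auto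
  \<comment> \<open>The other coordinates are irrelevant for the leg to \<open>E\<close>; the unit
    lies in every stabilizer.\<close>
  have "(i, g, \<lambda>j\<in>I - {i}. \<one>) \<in> tot bibundle" using ig S_closed(1) by (auto simp: tot_bibundle)
  then show "\<exists>u\<in>tot bibundle. snd (proj bibundle u) = a"
    by (rule bexI[rotated]) (simp add: proj_bibundle ig(3))
next
  fix u u' assume uE: "u \<in> tot bibundle" and uE': "u' \<in> tot bibundle"
    and eq: "snd (proj bibundle u) = snd (proj bibundle u')"
  obtain i g t where u: "u = (i, g, t)" "i \<in> I" "g \<in> carrier G" "t \<in> (\<Pi>\<^sub>E j\<in>I - {i}. S j)"
    using tot_bibundleE[OF uE] by blast
  obtain i' g' t' where u': "u' = (i', g', t')" "i' \<in> I" "g' \<in> carrier G" "t' \<in> (\<Pi>\<^sub>E j\<in>I - {i'}. S j)"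
    using tot_bibundleE[OF uE'] by blast
  have same: "\<phi> g (rep i) = \<phi> g' (rep i')" using eq by (simp add: u(1) u'(1) proj_bibundle)
  then have i': "i' = i" using rep_unique u u' by metis
  \<comment> \<open>The solution of \<open>g \<otimes> inv (p i) = g'\<close> and
    \<open>p j \<otimes> t j = t' j\<close>. Its coordinate at \<open>i\<close> lies in the
    stabilizer because \<open>g\<close> and \<open>g'\<close> send \<open>rep i\<close> to the same
    point. Each equation determines one coordinate, whence uniqueness.\<close>
  define p where "p = (\<lambda>j\<in>I. if j = i then inv g' \<otimes> g else t' j \<otimes> inv (t j))"
  have "\<phi> (inv g') (\<phi> g (rep i)) = rep i"
    using orbit_sym_aux[OF u'(3) rep_in[OF u'(2)]] same i' by simp
  then have "inv g' \<otimes> g \<in> S i"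
    using u(3) u'(3) rep_in[OF u(2)] by (simp add: stabilizer_def composition_rule)
  then have p: "p \<in> (\<Pi>\<^sub>E j\<in>I. S j)"
    using u(4) u'(4) S_closed i' unfolding p_def by (auto simp: PiE_iff)
  have tj: "t j \<in> carrier G" "t' j \<in> carrier G" if "j \<in> I - {i}" for j
    using that u(4) u'(4) i' S_D(1) by (auto simp: PiE_iff)
  have act: "act bibundle (q, \<one>) u = (i, g \<otimes> inv (q i), \<lambda>j\<in>I - {i}. q j \<otimes> t j)" for q
    using uE u(3) unfolding u(1) by (simp add: act_bibundle)
  show "\<exists>!h. h \<in> carrier (grp B) \<and> act bibundle (h, \<one>\<^bsub>grp A\<^esub>) u = u'"
  proof (rule ex1I[of _ p])
    have "g \<otimes> inv (p i) = g'"
      using u(2,3) u'(3) by (simp add: p_def inv_mult_group flip: m_assoc)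
    moreover have "(\<lambda>j\<in>I - {i}. p j \<otimes> t j) = t'"
    proof
      fix j show "(\<lambda>j\<in>I - {i}. p j \<otimes> t j) j = t' j"
        using tj u'(4) i' by (cases "j \<in> I - {i}") (auto simp: p_def m_assoc PiE_iff extensional_def)
    qed
    ultimately show "p \<in> carrier (grp B) \<and> act bibundle (p, \<one>\<^bsub>grp A\<^esub>) u = u'"
      using p by (simp add: grp_B act u'(1) i')
  next
    fix q assume "q \<in> carrier (grp B) \<and> act bibundle (q, \<one>\<^bsub>grp A\<^esub>) u = u'"
    then have q: "q \<in> (\<Pi>\<^sub>E j\<in>I. S j)" and gq: "g \<otimes> inv (q i) = g'"
      and tq: "(\<lambda>j\<in>I - {i}. q j \<otimes> t j) = t'"
      by (simp_all add: grp_B act u'(1) i')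
    have qj: "q j \<in> carrier G" if "j \<in> I" for j using q that S_D(1) by (auto simp: PiE_iff)
    show "q = p"
    proof (rule PiE_ext[OF q p])
      fix j assume j: "j \<in> I"
      show "q j = p j"
      proof (cases "j = i")
        case True
        have "inv g' \<otimes> g = q i"
          using u(2,3) qj by (simp add: gq[symmetric] inv_mult_group m_assoc)
        then show ?thesis using True j by (simp add: p_def)
      next
        case False
        then have "t' j = q j \<otimes> t j" using j tq[symmetric] by simp
        then show ?thesis using False j tj qj by (simp add: p_def m_assoc)
      qed
    qed
  qed
qed

text \<open>The leg to \<open>pts B\<close> forgets exactly the coordinate in \<open>G\<close>, on
  which \<open>G\<close> acts by left translation. Hence \<open>g' \<otimes> inv g\<close> is the
  only element that carries \<open>g\<close> to \<open>g'\<close>.\<close>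

lemma right_principal_bibundle: "left_principal A B (span_op bibundle)"
  unfolding left_principal_def
proof (intro conjI ballI impI)
  show "gset_over (ext_prod A B) (span_op bibundle)"
    using is_group by (intro gset_over_span_op gset_over_bibundle group_B) simp
next
  fix y assume "y \<in> pts B"
  then obtain i t where y: "y = (i, (), t)" "i \<in> I" "t \<in> (\<Pi>\<^sub>E j\<in>I - {i}. S j)"
    unfolding pts_B by blast
  then have "(i, \<one>, t) \<in> tot bibundle" by (simp add: tot_bibundle)
  then show "\<exists>u\<in>tot (span_op bibundle). snd (proj (span_op bibundle) u) = y"
    by (intro bexI[of _ "(i, \<one>, t)"]) (simp_all add: proj_bibundle y(1))
next
  fix u u' assume uE: "u \<in> tot (span_op bibundle)" and uE': "u' \<in> tot (span_op bibundle)"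
    and eq: "snd (proj (span_op bibundle) u) = snd (proj (span_op bibundle) u')"
  obtain i g t where u: "u = (i, g, t)" "i \<in> I" "g \<in> carrier G" "t \<in> (\<Pi>\<^sub>E j\<in>I - {i}. S j)"
    using uE by (auto elim: tot_bibundleE)
  obtain i' g' t' where u': "u' = (i', g', t')" "g' \<in> carrier G"
    using uE' by (auto elim: tot_bibundleE)
  have same: "i' = i" "t' = t" using eq by (simp_all add: u(1) u'(1) proj_bibundle)
  have act: "act bibundle (\<one>\<^bsub>grp B\<^esub>, a) u = (i, a \<otimes> g, t)" if "a \<in> carrier G" for a
    using uE u(2,3) that translate_one[OF u(4)] unfolding u(1) by (simp add: act_bibundle grp_B)
  show "\<exists>!a. a \<in> carrier (grp A) \<and> act (span_op bibundle) (a, \<one>\<^bsub>grp B\<^esub>) u = u'"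
    by (rule ex1I[of _ "g' \<otimes> inv g"])
      (use u(3) u'(2) same in \<open>auto simp: act u'(1) m_assoc\<close>)
qed

end

theorem mainTheorem7:
  fixes R :: "('r, 'm) ring_scheme"
    and G :: "'g monoid"
    and Xset :: "'x set"
    and \<phi> :: "'g \<Rightarrow> 'x \<Rightarrow> 'x"
    and n :: nat
    and Orb :: "nat \<Rightarrow> 'x set"
    and x :: "nat \<Rightarrow> 'x"
  assumes "cring R"
    and "group G" and "finite (carrier G)"
    and "group_action G Xset \<phi>" and "finite Xset"
    and "bij_betw Orb {1..n} (orbits G Xset \<phi>)"
    and "\<And>i. i \<in> {1..n} \<Longrightarrow> x i \<in> Orb i"
  shows "cr_isomorphic R \<lparr>grp = G, pts = Xset, gact = \<phi>\<rparr>
           (dir_sum {1..n} (\<lambda>i. point (G\<lparr>carrier := stabilizer G \<phi> (x i)\<rparr>)))"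
proof -
  interpret action: group_action G Xset \<phi> by fact
  \<comment> \<open>The set \<open>Orb i\<close> and the orbit of \<open>x i\<close> are both orbits
    and share the point \<open>x i\<close>, so disjointness of orbits makes them equal.\<close>
  have Orb: "x i \<in> Xset \<and> Orb i = orbit G \<phi> (x i)" if i: "i \<in> {1..n}" for i
  proof -
    have O: "Orb i \<in> orbits G Xset \<phi>" using bij_betwE[OF assms(6)] i by blast
    then have xX: "x i \<in> Xset" using assms(7)[OF i] action.orbits_coverture by blast
    then have "orbit G \<phi> (x i) \<in> orbits G Xset \<phi>" by (auto simp: orbits_def)
    then show ?thesis
      using action.disjoint_union[OF O] action.orbit_refl[OF xX] assms(7)[OF i] xX by blast
  qed
  interpret orbit_representatives G Xset \<phi> "{1..n}" x
  proof unfold_locales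
    show "finite (carrier G)" "finite {1..n}" by (simp_all add: assms(3))
    show "x i \<in> Xset" if "i \<in> {1..n}" for i using Orb[OF that] by simp
  next
    fix y assume y: "y \<in> Xset"
    then have "orbit G \<phi> y \<in> Orb ` {1..n}"
      using bij_betw_imp_surj_on[OF assms(6)] by (auto simp: orbits_def)
    then obtain i where i: "i \<in> {1..n}" "orbit G \<phi> y = Orb i" by blast
    then have "y \<in> orbit G \<phi> (x i)" using action.orbit_refl[OF y] Orb by simp
    then show "\<exists>i\<in>{1..n}. \<exists>g\<in>carrier G. \<phi> g (x i) = y" using i(1) by (auto simp: orbit_def)
  next
    fix i j g h
    assume ij: "i \<in> {1..n}" "j \<in> {1..n}" and gh: "g \<in> carrier G" "h \<in> carrier G"
      and eq: "\<phi> g (x i) = \<phi> h (x j)"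
    have orbs: "Orb i \<in> orbits G Xset \<phi>" "Orb j \<in> orbits G Xset \<phi>"
      using bij_betwE[OF assms(6)] ij by blast+
    \<comment> \<open>A common translate lies in both orbits, so they coincide. Since
      \<open>Orb\<close> lists each orbit only once, the indices are then equal.\<close>
    have "\<phi> g (x i) \<in> Orb i \<inter> Orb j"
      using Orb[OF ij(1)] Orb[OF ij(2)] gh eq by (auto simp: orbit_def)
    then have "Orb i = Orb j" using action.disjoint_union[OF orbs] by blast
    then show "i = j" using inj_onD[OF bij_betw_imp_inj_on[OF assms(6)]] ij by blast
  qed
  show ?thesis
    by (rule cr_isomorphic_if_principal[OF assms(1) _ _ _ action_B finite_B left_principal_bibundle
          right_principal_bibundle]) (simp_all add: assms(3-5))
qed

end
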